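(* For each modular expression $\mathcal E$ made up from finite plain modules, and its representation $\iota(\mathcal E)$ as a structured module, $\mathcal T_{\mathcal E}=\mathcal U_{\iota(\mathcal E)}$ (as maps on $\mathbf{CTAlg}_\Sigma$).
   Context: Terms. $\Sigma=(DS_\Sigma,FS_\Sigma)$ (the visible signature) consists of countable disjoint sets of constructor symbols and of (defined) function symbols, each with an arity. $\mathcal V$ is a countably infinite set of variables; $\bot$ is an extra 0-ary constructor. $\mathbf{Term}_\bot$ is the set of terms over $DS_\Sigma\cup FS_\Sigma\cup\{\bot\}$ and $\mathcal V$; $\mathbf{CTerm}_\bot$ is the subset of terms without function symbols; $\mathbf{Term}$, $\mathbf{CTerm}$ are the respective subsets of terms not containing $\bot$. $\mathbf{CSubst}_\bot$ (resp. $\mathbf{CSubst}$) is the set of maps $\theta:\mathcal V\to\mathbf{CTerm}_\bot$ (resp. $\mathcal V\to\mathbf{CTerm}$), extended to terms, written $t\theta$. Formulas are reduction statements $a\to b$ and joinability statements $a\bowtie b$, $a,b\in\mathbf{Term}_\bot$. $\sqsubseteq$ is the least partial order on $\mathbf{CTerm}_\bot$ with $\bot\sqsubseteq t$ and $c(\overline s)\sqsubseteq c(\overline t)$ whenever $c$ is a constructor and $s_i\sqsubseteq t_i$ for all $i$; $\langle t\rangle=\{s\mid s\sqsubseteq t\}$. A cone is a non-empty subset of $\mathbf{CTerm}_\bot$ closed downwards under $\sqsubseteq$. Programs. A program is a set $\mathcal R$ of rules $f(\overline t)\to r\Leftarrow C$ with $f$ a function symbol, $\overline t$ a tuple of terms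 of $\mathbf{CTerm}$ in which no variable occurs twice, $r\in\mathbf{Term}_\bot$, $C$ a finite set of joinability statements between terms of $\mathbf{Term}$. $[\mathcal R]_\bot$ is the set of instances $(l\to r\Leftarrow C)\theta$ of its rules with $\theta\in\mathbf{CSubst}_\bot$. $\mathcal R\vdash_{CRWL}\varphi$ means derivability with: (Bo) $e\to\bot$; (RR) $e\to e$ for $e$ a variable or 0-ary constructor symbol of $DS_\Sigma$; (DS) from all $e_i\to t_i$ infer $c(\overline e)\to c(\overline t)$, $c\in DS_\Sigma$; (OR) from all $e_i\to t_i$, all of $C$, and $r\to t$ infer $f(\overline e)\to t$, if $(f(\overline t)\to r\Leftarrow C)\in[\mathcal R]_\bot$ and $t\ne\bot$; (Jo) from $a\to t$, $b\to t$ with $t\in\mathbf{CTerm}$ infer $a\bowtie b$. Term algebras. A term algebra $\mathcal A$ over a signature has carrier $\mathbf{CTerm}_\bot$, interprets each constructor $c$ by $c^{\mathcal A}(\overline t)=\langle c(\overline t)\rangle$ and each function symbol $f$ by a monotonic map $f^{\mathcal A}$ from tuples of $\mathbf{CTerm}_\bot$ to cones ordered by inclusion. $\mathcal A\sqsubseteq\mathcal B$ iff $f^{\mathcal A}(\overline t)\subseteq f^{\mathcal B}(\overline t)$ for all $f,\overline t$; $\sqcup$ is given by unions of the sets $f^{\mathcal A}(\overline t)$; the bottom algebra interprets every function symbol by the constant $\{\bot\}$. $\mathcal A$ is consistent iff $\{u\theta\mid u\in f^{\mathcal A}(\overline t)\}\subseteq f^{\mathcal A}(\overline t\theta)$ for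 all $f$, $\overline t$, $\theta\in\mathbf{CSubst}$; $\mathbf{CTAlg}_\Sigma$ is the set of consistent term algebras over $\Sigma$. Evaluation under $\eta:\mathcal V\to\mathbf{CTerm}_\bot$: $[\![\bot]\!]^{\mathcal A}_\eta=\langle\bot\rangle$, $[\![X]\!]^{\mathcal A}_\eta=\langle\eta(X)\rangle$, $[\![h(\overline e)]\!]^{\mathcal A}_\eta=\bigcup\{h^{\mathcal A}(\overline u)\mid u_i\in[\![e_i]\!]^{\mathcal A}_\eta\}$. $\mathcal A\models_{id}C$ iff for each $a\bowtie b$ in $C$ the set $[\![a]\!]^{\mathcal A}_{id}\cap[\![b]\!]^{\mathcal A}_{id}$ contains an element of $\mathbf{CTerm}$ ($id$ the identity valuation). For a program $\mathcal R$, $f^{\mathcal T_{\mathcal R}(\mathcal A)}(\overline t)=\{t\mid\exists(f(\overline s)\to r\Leftarrow C)\in[\mathcal R]_\bot,\ s_i\sqsubseteq t_i,\ \mathcal A\models_{id}C,\ t\in[\![r]\!]^{\mathcal A}_{id}\}\cup\{\bot\}$; $\mathcal T_{\mathcal R}$ maps consistent algebras to consistent ones, and $\mathcal T^\omega_{\mathcal R}$ applied to the bottom algebra denotes the join of the iterates of $\mathcal T_{\mathcal R}$ from it. Plain modules. A plain module is $\mathcal P=\langle\sigma_p,\sigma_e,\mathcal R\rangle$ with $\mathcal R=rl(\mathcal P)$ a program over $\Sigma$ with right-hand sides $\ne\bot$, $\sigma_e=exp(\mathcal P)$ the function symbols with a defining rule in $\mathcal R$, $\sigma_p$ those occurring in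 $\mathcal R$ without defining rule. It is finite if $\mathcal R$ is finite. $\mathcal T_{\mathcal P}=\mathcal T_{rl(\mathcal P)}$. Operations: $\mathcal P\cup\mathcal Q$ (union of rule sets); $\mathcal P\setminus\sigma$ for $\sigma\subseteq FS_\Sigma$ (keep only rules defining symbols not in $\sigma$); $\rho(\mathcal P)$ for an arity-preserving $\rho:FS_\Sigma\to FS_\Sigma$ (replace every function symbol $f$ by $\rho(f)$ in all rules); closure $\overline{\mathcal P}$, whose rules are the $crr(f(\overline t),r)$ with $f\in exp(\mathcal P)$, $t_i,r\in\mathbf{CTerm}_\bot$, $r\neq\bot$, $rl(\mathcal P)\vdash_{CRWL}f(\overline t)\to r$, where $crr(f(\overline t),r)$ is the rule $f(\overline t')\to r\Leftarrow C$ obtained by replacing in $\overline t$ each occurrence of $\bot$ and each non-first occurrence of a repeated variable by a distinct fresh variable, with $C$ consisting of $X\bowtie Y$ for each fresh $Y$ replacing an occurrence of a repeated variable $X$, and $X\bowtie X$ for each variable $X$ of $r$ and each variable occurring exactly once in $\overline t$. Modular expressions are the syntactic expressions built from names of finite plain modules with $\cup$, $(\cdot)\setminus\sigma$, $\rho(\cdot)$ and $\overline{(\cdot)}$; each denotes a (possibly infinite) plain module, and $\mathcal T_{\mathcal E}$ is the operator of the plain module denoted by $\mathcal E$. Structured modules. $\Omega$ is the set of labels, identified with the module names and modular expressions. The labeled (hidden) function symbols are the pairs $\mathcal P.f$ with $\mathcal P\in\Omega$, $f\in FS_\Sigma$ (same arity as $f$); $\overline\Sigma=(DS_\Sigma,FS_\Sigma\cup(\Omega\times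 FS_\Sigma))$. A structured module is $\langle\sigma_p,\sigma_e,\mathcal R_V\cup\mathcal R_B\cup\mathcal R_H\rangle$ where the visible part $\mathcal R_V$ consists of rules with function symbols only in $FS_\Sigma$, the hidden part $\mathcal R_H$ of rules with function symbols only in $\Omega\times FS_\Sigma$, and the bridge part $\mathcal R_B$ of rules $f(\overline X)\to\mathcal P.g(\overline X)$ (with $f,g\in FS_\Sigma$, $\overline X$ distinct variables) such that $\mathcal P.g$ has a defining rule in $\mathcal R_H$; $\sigma_e$ is the set of function symbols with a defining rule in $\mathcal R_V\cup\mathcal R_B$, and $\sigma_p$ the set of parameter function symbols appearing in $\mathcal R_V$. A plain module is a structured module with $\mathcal R_B=\mathcal R_H=\emptyset$. Union, deletion and renaming are defined on structured modules as for plain modules (on the rule sets), deletion and renaming involving visible symbols only (labeled symbols and hidden rules are unchanged). The structured closure of a structured module $\langle\sigma_p,\sigma_e,\mathcal R_V\cup\mathcal R_B\cup\mathcal R_H\rangle$ with label $\mathcal P$ (where $\mathcal R_V$, $\mathcal R_B$, $\mathcal R_H$ are its visible, bridge and hidden parts) is $\mathcal P^*=\langle\emptyset,\sigma_e,\mathcal R_B^*\cup\mathcal R_H^*\rangle$ with $\mathcal R_B^*=\{f(\overline X)\to\mathcal P.f(\overline X)\mid f\in\sigma_e\}$ and $\mathcal R_H^*=\tau(\mathcal R_V\cup\mathcal R_B)\cup\mathcal R_H$, where $\tau$ replaces each visible function symbol $f$ by $\mathcal P.f$ and keeps labeled symbols. Representation. $\iota(\mathcal P)=\mathcal P$ for a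 finite plain module; $\iota(\mathcal P\cup\mathcal Q)=\iota(\mathcal P)\cup\iota(\mathcal Q)$; $\iota(\mathcal P\setminus\sigma)=\iota(\mathcal P)\setminus\sigma$; $\iota(\rho(\mathcal P))=\rho(\iota(\mathcal P))$; $\iota(\overline{\mathcal P})=(\iota(\mathcal P))^*$, the label used being the one of the expression $\mathcal P$. For a structured module $\mathcal P=\langle\sigma_p,\sigma_e,\mathcal R_V\cup\mathcal R_B\cup\mathcal R_H\rangle$, $\mathcal U_{\mathcal P}:\mathbf{CTAlg}_\Sigma\to\mathbf{CTAlg}_\Sigma$ is $\mathcal U_{\mathcal P}(\mathcal A)=\mathcal T_{\mathcal R_V\cup\mathcal R_B}\big(\mathcal T^\omega_{\mathcal R_H}(\bot_{\overline\Sigma})\sqcup\overline{\mathcal A}\big)|_\Sigma$, where $\bot_{\overline\Sigma}$ is the bottom term algebra over $\overline\Sigma$, $\overline{\mathcal A}$ extends $\mathcal A$ to $\overline\Sigma$ by interpreting every labeled symbol as the constant $\{\bot\}$, and $|_\Sigma$ forgets the interpretations of labeled symbols. *)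

theory Defs
  imports Main "HOL-Library.Countable_Set" "HOL-Library.FuncSet"
begin

section \<open>Terms\<close>

text \<open>Constructor and function symbols live in different types, so that the two symbol sets
  of a signature are disjoint.\<close>

record ('c, 'f) sig =
  DS :: "'c set"
  FS :: "'f set"
  arD :: "'c \<Rightarrow> nat"
  arF :: "'f \<Rightarrow> nat"

definition signature :: "('c, 'f) sig \<Rightarrow> bool" where
  "signature sg \<longleftrightarrow> countable (DS sg) \<and> countable (FS sg)"

text \<open>Constructor terms have a type of their own, independent of the function symbols, because
  they are the carrier of the term algebras over \<open>\<Sigma>\<close> as well as of those over \<open>\<Sigma>\<close> extended by
  labeled symbols. The map \<open>emb\<close> is the inclusion into the type of all terms.\<close>

datatype (ct_vars: 'v, 'c) ct =
    CBot | CVar 'v | CCon 'c "('v, 'c) ct list"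

datatype (trm_vars: 'v, 'c, trm_funs: 'f) trm =
    Bot | Var 'v | Con 'c "('v, 'c, 'f) trm list" | Fun 'f "('v, 'c, 'f) trm list"
  for map: map_trm

primrec emb :: "('v, 'c) ct \<Rightarrow> ('v, 'c, 'f) trm" where
  "emb CBot = Bot"
| "emb (CVar x) = Var x"
| "emb (CCon c ts) = Con c (map emb ts)"

fun wf_ct :: "('c, 'f) sig \<Rightarrow> ('v, 'c) ct \<Rightarrow> bool" where
  "wf_ct sg CBot \<longleftrightarrow> True"
| "wf_ct sg (CVar x) \<longleftrightarrow> True"
| "wf_ct sg (CCon c ts) \<longleftrightarrow> c \<in> DS sg \<and> length ts = arD sg c \<and> (\<forall>t \<in> set ts. wf_ct sg t)"

fun wf_trm :: "('c, 'f) sig \<Rightarrow> ('v, 'c, 'f) trm \<Rightarrow> bool" where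
  "wf_trm sg Bot \<longleftrightarrow> True"
| "wf_trm sg (Var x) \<longleftrightarrow> True"
| "wf_trm sg (Con c ts) \<longleftrightarrow> c \<in> DS sg \<and> length ts = arD sg c \<and> (\<forall>t \<in> set ts. wf_trm sg t)"
| "wf_trm sg (Fun f ts) \<longleftrightarrow> f \<in> FS sg \<and> length ts = arF sg f \<and> (\<forall>t \<in> set ts. wf_trm sg t)"

fun total_ct :: "('v, 'c) ct \<Rightarrow> bool" where
  "total_ct CBot \<longleftrightarrow> False"
| "total_ct (CVar x) \<longleftrightarrow> True"
| "total_ct (CCon c ts) \<longleftrightarrow> (\<forall>t \<in> set ts. total_ct t)"

fun total_trm :: "('v, 'c, 'f) trm \<Rightarrow> bool" where
  "total_trm Bot \<longleftrightarrow> False"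
| "total_trm (Var x) \<longleftrightarrow> True"
| "total_trm (Con c ts) \<longleftrightarrow> (\<forall>t \<in> set ts. total_trm t)"
| "total_trm (Fun f ts) \<longleftrightarrow> (\<forall>t \<in> set ts. total_trm t)"

definition CTerm_bot :: "('c, 'f) sig \<Rightarrow> ('v, 'c) ct set" where
  "CTerm_bot sg = {t. wf_ct sg t}"

definition CTerm :: "('c, 'f) sig \<Rightarrow> ('v, 'c) ct set" where
  "CTerm sg = {t. wf_ct sg t \<and> total_ct t}"

definition Term_bot :: "('c, 'f) sig \<Rightarrow> ('v, 'c, 'f) trm set" where
  "Term_bot sg = {t. wf_trm sg t}"

definition Term :: "('c, 'f) sig \<Rightarrow> ('v, 'c, 'f) trm set" where
  "Term sg = {t. wf_trm sg t \<and> total_trm t}"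

definition CSubst_bot :: "('c, 'f) sig \<Rightarrow> ('v \<Rightarrow> ('v, 'c) ct) set" where
  "CSubst_bot sg = {\<theta>. \<forall>x. \<theta> x \<in> CTerm_bot sg}"

definition CSubst :: "('c, 'f) sig \<Rightarrow> ('v \<Rightarrow> ('v, 'c) ct) set" where
  "CSubst sg = {\<theta>. \<forall>x. \<theta> x \<in> CTerm sg}"

primrec subst_ct :: "('v \<Rightarrow> ('v, 'c) ct) \<Rightarrow> ('v, 'c) ct \<Rightarrow> ('v, 'c) ct" where
  "subst_ct \<theta> CBot = CBot"
| "subst_ct \<theta> (CVar x) = \<theta> x"
| "subst_ct \<theta> (CCon c ts) = CCon c (map (subst_ct \<theta>) ts)"

primrec subst_trm :: "('v \<Rightarrow> ('v, 'c) ct) \<Rightarrow> ('v, 'c, 'f) trm \<Rightarrow> ('v, 'c, 'f) trm" where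
  "subst_trm \<theta> Bot = Bot"
| "subst_trm \<theta> (Var x) = emb (\<theta> x)"
| "subst_trm \<theta> (Con c ts) = Con c (map (subst_trm \<theta>) ts)"
| "subst_trm \<theta> (Fun f ts) = Fun f (map (subst_trm \<theta>) ts)"

text \<open>The least reflexive and transitive relation closed under the two rules; it is antisymmetric
  (see \<open>approx_antisym\<close>), hence the least partial order.\<close>

inductive approx :: "('v, 'c) ct \<Rightarrow> ('v, 'c) ct \<Rightarrow> bool"  (infix "\<sqsubseteq>" 50) where
  approx_bot: "CBot \<sqsubseteq> t"
| approx_con: "list_all2 (\<sqsubseteq>) ss ts \<Longrightarrow> CCon c ss \<sqsubseteq> CCon c ts"
| approx_refl: "t \<sqsubseteq> t"
| approx_trans: "s \<sqsubseteq> t \<Longrightarrow> t \<sqsubseteq> u \<Longrightarrow> s \<sqsubseteq> u"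

fun ct_size :: "('v, 'c) ct \<Rightarrow> nat" where
  "ct_size CBot = 0"
| "ct_size (CVar x) = 1"
| "ct_size (CCon c ts) = Suc (sum_list (map ct_size ts))"

lemma ct_size_list: "list_all2 (\<lambda>s t. ct_size s \<le> ct_size t \<and> (ct_size s = ct_size t \<longrightarrow> s = t)) ss ts \<Longrightarrow>
   sum_list (map ct_size ss) \<le> sum_list (map ct_size ts) \<and>
   (sum_list (map ct_size ss) = sum_list (map ct_size ts) \<longrightarrow> ss = ts)"
  by (induction rule: list_all2_induct) auto

lemma approx_size: "s \<sqsubseteq> t \<Longrightarrow> ct_size s \<le> ct_size t \<and> (ct_size s = ct_size t \<longrightarrow> s = t)"
proof (induction rule: approx.induct)
  case (approx_bot t) then show ?case by (cases t) auto
next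
  case (approx_con ss ts c)
  then have "list_all2 (\<lambda>s t. ct_size s \<le> ct_size t \<and> (ct_size s = ct_size t \<longrightarrow> s = t)) ss ts"
    by (auto elim: list.rel_mono_strong)
  from ct_size_list[OF this] show ?case by auto
qed auto

lemma approx_antisym: "s \<sqsubseteq> t \<Longrightarrow> t \<sqsubseteq> s \<Longrightarrow> s = t"
  using approx_size by (metis le_antisym)

definition down :: "('v, 'c) ct \<Rightarrow> ('v, 'c) ct set" where
  "down t = {s. s \<sqsubseteq> t}"

definition cone :: "('c, 'f) sig \<Rightarrow> ('v, 'c) ct set \<Rightarrow> bool" where
  "cone sg K \<longleftrightarrow> K \<noteq> {} \<and> K \<subseteq> CTerm_bot sg \<and> (\<forall>t \<in> K. \<forall>s. s \<sqsubseteq> t \<longrightarrow> s \<in> K)"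

fun var_occs :: "('v, 'c) ct \<Rightarrow> 'v list" where
  "var_occs CBot = []"
| "var_occs (CVar x) = [x]"
| "var_occs (CCon c ts) = concat (map var_occs ts)"

section \<open>Programs and the calculus CRWL\<close>

text \<open>A pair \<open>(a, b)\<close> in the condition of a rule is the joinability statement between \<open>a\<close> and
  \<open>b\<close>.\<close>

datatype ('v, 'c, 'f) rule =
  Rule (head: 'f) (args: "('v, 'c) ct list") (rhs: "('v, 'c, 'f) trm")
    (conds: "(('v, 'c, 'f) trm \<times> ('v, 'c, 'f) trm) set")

fun wf_rule :: "('c, 'f) sig \<Rightarrow> ('v, 'c, 'f) rule \<Rightarrow> bool" where
  "wf_rule sg (Rule f ts r C) \<longleftrightarrow>
     f \<in> FS sg \<and> length ts = arF sg f \<and> set ts \<subseteq> CTerm sg \<and>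
     distinct (concat (map var_occs ts)) \<and>
     r \<in> Term_bot sg \<and> finite C \<and> C \<subseteq> Term sg \<times> Term sg"

definition is_program :: "('c, 'f) sig \<Rightarrow> ('v, 'c, 'f) rule set \<Rightarrow> bool" where
  "is_program sg R \<longleftrightarrow> (\<forall>\<rho> \<in> R. wf_rule sg \<rho>)"

fun subst_rule :: "('v \<Rightarrow> ('v, 'c) ct) \<Rightarrow> ('v, 'c, 'f) rule \<Rightarrow> ('v, 'c, 'f) rule" where
  "subst_rule \<theta> (Rule f ts r C) =
     Rule f (map (subst_ct \<theta>) ts) (subst_trm \<theta> r)
       (map_prod (subst_trm \<theta>) (subst_trm \<theta>) ` C)"

definition instances :: "('c, 'f) sig \<Rightarrow> ('v, 'c, 'f) rule set \<Rightarrow> ('v, 'c, 'f) rule set" where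
  "instances sg R = {subst_rule \<theta> \<rho> | \<theta> \<rho>. \<theta> \<in> CSubst_bot sg \<and> \<rho> \<in> R}"

datatype ('v, 'c, 'f) formula =
    Red "('v, 'c, 'f) trm" "('v, 'c, 'f) trm"  (infix "\<rightarrow>\<^sub>r" 55)
  | Join "('v, 'c, 'f) trm" "('v, 'c, 'f) trm"  (infix "\<bowtie>" 55)

inductive crwl :: "('c, 'f) sig \<Rightarrow> ('v, 'c, 'f) rule set \<Rightarrow> ('v, 'c, 'f) formula \<Rightarrow> bool"
  for sg :: "('c, 'f) sig" and R :: "('v, 'c, 'f) rule set" where
  Bo: "e \<in> Term_bot sg \<Longrightarrow> crwl sg R (e \<rightarrow>\<^sub>r Bot)"
| RR_var: "crwl sg R (Var x \<rightarrow>\<^sub>r Var x)"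
| RR_con: "c \<in> DS sg \<Longrightarrow> arD sg c = 0 \<Longrightarrow> crwl sg R (Con c [] \<rightarrow>\<^sub>r Con c [])"
| DC: "c \<in> DS sg \<Longrightarrow> length es = arD sg c \<Longrightarrow>
    list_all2 (\<lambda>e t. crwl sg R (e \<rightarrow>\<^sub>r t)) es ts \<Longrightarrow>
    crwl sg R (Con c es \<rightarrow>\<^sub>r Con c ts)"
| OR: "Rule f ts r C \<in> instances sg R \<Longrightarrow>
    list_all2 (\<lambda>e t. crwl sg R (e \<rightarrow>\<^sub>r emb t)) es ts \<Longrightarrow>
    (\<forall>a b. (a, b) \<in> C \<longrightarrow> crwl sg R (a \<bowtie> b)) \<Longrightarrow>
    crwl sg R (r \<rightarrow>\<^sub>r t) \<Longrightarrow> t \<noteq> Bot \<Longrightarrow>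
    crwl sg R (Fun f es \<rightarrow>\<^sub>r t)"
| Jo: "t \<in> CTerm sg \<Longrightarrow> crwl sg R (a \<rightarrow>\<^sub>r emb t) \<Longrightarrow> crwl sg R (b \<rightarrow>\<^sub>r emb t) \<Longrightarrow>
    crwl sg R (a \<bowtie> b)"

section \<open>Term algebras\<close>

text \<open>Carrier and constructors have a fixed interpretation, so a term algebra is given by its
  interpretation of the function symbols. Only the values at function symbols of the signature
  and argument tuples in \<open>tuples\<close> are meaningful; accordingly, equality of algebras is
  \<open>alg_eq\<close>. Joins of algebras are those of the pointwise order on functions into sets.\<close>

type_synonym ('v, 'c, 'f) alg = "'f \<Rightarrow> ('v, 'c) ct list \<Rightarrow> ('v, 'c) ct set"

definition tuples :: "('c, 'f) sig \<Rightarrow> 'f \<Rightarrow> ('v, 'c) ct list set" where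
  "tuples sg f = {ts. length ts = arF sg f \<and> set ts \<subseteq> CTerm_bot sg}"

definition term_alg :: "('c, 'f) sig \<Rightarrow> ('v, 'c, 'f) alg \<Rightarrow> bool" where
  "term_alg sg A \<longleftrightarrow> (\<forall>f \<in> FS sg.
     (\<forall>ts \<in> tuples sg f. cone sg (A f ts)) \<and>
     (\<forall>ss \<in> tuples sg f. \<forall>ts \<in> tuples sg f. list_all2 (\<sqsubseteq>) ss ts \<longrightarrow> A f ss \<subseteq> A f ts))"

definition consistent :: "('c, 'f) sig \<Rightarrow> ('v, 'c, 'f) alg \<Rightarrow> bool" where
  "consistent sg A \<longleftrightarrow> (\<forall>f \<in> FS sg. \<forall>ts \<in> tuples sg f. \<forall>\<theta> \<in> CSubst sg.
     subst_ct \<theta> ` A f ts \<subseteq> A f (map (subst_ct \<theta>) ts))"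

definition CTAlg :: "('c, 'f) sig \<Rightarrow> ('v, 'c, 'f) alg set" where
  "CTAlg sg = {A. term_alg sg A \<and> consistent sg A}"

definition alg_eq :: "('c, 'f) sig \<Rightarrow> ('v, 'c, 'f) alg \<Rightarrow> ('v, 'c, 'f) alg \<Rightarrow> bool" where
  "alg_eq sg A B \<longleftrightarrow> (\<forall>f \<in> FS sg. \<forall>ts \<in> tuples sg f. A f ts = B f ts)"

definition bot_alg :: "('v, 'c, 'f) alg" where
  "bot_alg = (\<lambda>f ts. {CBot})"

primrec eval ::
    "('v, 'c, 'f) alg \<Rightarrow> ('v \<Rightarrow> ('v, 'c) ct) \<Rightarrow> ('v, 'c, 'f) trm \<Rightarrow> ('v, 'c) ct set" where
  "eval A \<eta> Bot = down CBot"
| "eval A \<eta> (Var x) = down (\<eta> x)"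
| "eval A \<eta> (Con c es) = (\<Union>us \<in> listset (map (eval A \<eta>) es). down (CCon c us))"
| "eval A \<eta> (Fun f es) = (\<Union>us \<in> listset (map (eval A \<eta>) es). A f us)"

text \<open>\<open>CVar\<close> is the identity valuation.\<close>

definition models_id ::
    "('c, 'f) sig \<Rightarrow> ('v, 'c, 'f) alg \<Rightarrow> (('v, 'c, 'f) trm \<times> ('v, 'c, 'f) trm) set \<Rightarrow> bool" where
  "models_id sg A C \<longleftrightarrow>
     (\<forall>(a, b) \<in> C. eval A CVar a \<inter> eval A CVar b \<inter> CTerm sg \<noteq> {})"

definition T_op ::
    "('c, 'f) sig \<Rightarrow> ('v, 'c, 'f) rule set \<Rightarrow> ('v, 'c, 'f) alg \<Rightarrow> ('v, 'c, 'f) alg" where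
  "T_op sg R A = (\<lambda>f ts.
     {t. \<exists>ss r C. Rule f ss r C \<in> instances sg R \<and> list_all2 (\<sqsubseteq>) ss ts \<and>
           models_id sg A C \<and> t \<in> eval A CVar r} \<union> {CBot})"

definition T_omega ::
    "('c, 'f) sig \<Rightarrow> ('v, 'c, 'f) rule set \<Rightarrow> ('v, 'c, 'f) alg \<Rightarrow> ('v, 'c, 'f) alg" where
  "T_omega sg R A = (SUP n. (T_op sg R ^^ n) A)"

section \<open>Plain modules\<close>

text \<open>The two interfaces of a module are determined by its rules: the exported symbols are the
  heads of the rules, and the parameters are not referred to by any of the operations. A plain
  module is therefore represented by its set of rules.\<close>

definition plain_module :: "('c, 'f) sig \<Rightarrow> ('v, 'c, 'f) rule set \<Rightarrow> bool" where
  "plain_module sg R \<longleftrightarrow> is_program sg R \<and> (\<forall>\<rho> \<in> R. rhs \<rho> \<noteq> Bot)"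

definition exports :: "('v, 'c, 'f) rule set \<Rightarrow> 'f set" where
  "exports R = head ` R"

definition delete :: "'f set \<Rightarrow> ('v, 'c, 'f) rule set \<Rightarrow> ('v, 'c, 'f) rule set" where
  "delete \<sigma> R = {\<rho> \<in> R. head \<rho> \<notin> \<sigma>}"

fun map_rule_funs :: "('f \<Rightarrow> 'g) \<Rightarrow> ('v, 'c, 'f) rule \<Rightarrow> ('v, 'c, 'g) rule" where
  "map_rule_funs h (Rule f ts r C) =
     Rule (h f) ts (map_trm id id h r) (map_prod (map_trm id id h) (map_trm id id h) ` C)"

text \<open>A sequence of distinct variables outside \<open>V\<close>; it exists for finite \<open>V\<close> as there are
  infinitely many variables.\<close>

definition fresh :: "'v set \<Rightarrow> nat \<Rightarrow> 'v" where
  "fresh V = (SOME \<nu>. inj \<nu> \<and> range \<nu> \<inter> V = {})"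

text \<open>Traversal from left to right, replacing every occurrence of \<open>\<bottom>\<close> and every non-first
  occurrence of a variable by the next variable of \<open>\<nu>\<close>. The state consists of the variables
  already met, the index of the next variable of \<open>\<nu>\<close>, and the pairs \<open>(X, Y)\<close> such that \<open>Y\<close> has
  replaced an occurrence of \<open>X\<close>.\<close>

fun lin_ct :: "(nat \<Rightarrow> 'v) \<Rightarrow> ('v, 'c) ct \<Rightarrow> 'v set \<times> nat \<times> ('v \<times> 'v) set \<Rightarrow>
      ('v, 'c) ct \<times> ('v set \<times> nat \<times> ('v \<times> 'v) set)"
  and lin_cts :: "(nat \<Rightarrow> 'v) \<Rightarrow> ('v, 'c) ct list \<Rightarrow> 'v set \<times> nat \<times> ('v \<times> 'v) set \<Rightarrow>
      ('v, 'c) ct list \<times> ('v set \<times> nat \<times> ('v \<times> 'v) set)" where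
  "lin_ct \<nu> CBot (S, k, J) = (CVar (\<nu> k), (S, Suc k, J))"
| "lin_ct \<nu> (CVar x) (S, k, J) =
     (if x \<in> S then (CVar (\<nu> k), (S, Suc k, insert (x, \<nu> k) J))
      else (CVar x, (insert x S, k, J)))"
| "lin_ct \<nu> (CCon c ts) st = (let (ts', st') = lin_cts \<nu> ts st in (CCon c ts', st'))"
| "lin_cts \<nu> [] st = ([], st)"
| "lin_cts \<nu> (t # ts) st =
     (let (t', st1) = lin_ct \<nu> t st; (ts', st2) = lin_cts \<nu> ts st1 in (t' # ts', st2))"

definition crr :: "'f \<Rightarrow> ('v, 'c) ct list \<Rightarrow> ('v, 'c) ct \<Rightarrow> ('v, 'c, 'f) rule" where
  "crr f ts r =
     (let \<nu> = fresh (\<Union> (ct_vars ` set ts) \<union> ct_vars r);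
          (ts', _, _, J) = lin_cts \<nu> ts ({}, 0, {})
      in Rule f ts' (emb r)
           ({(Var x, Var y) | x y. (x, y) \<in> J} \<union>
            {(Var x, Var x) | x. x \<in> ct_vars r \<or>
                count_list (concat (map var_occs ts)) x = 1}))"

definition closure :: "('c, 'f) sig \<Rightarrow> ('v, 'c, 'f) rule set \<Rightarrow> ('v, 'c, 'f) rule set" where
  "closure sg R = {crr f ts r | f ts r.
     f \<in> exports R \<and> ts \<in> tuples sg f \<and> r \<in> CTerm_bot sg \<and> r \<noteq> CBot \<and>
     crwl sg R (Fun f (map emb ts) \<rightarrow>\<^sub>r emb r)}"

section \<open>Modular expressions\<close>

datatype ('n, 'f) mexp =
    Name 'n
  | Union "('n, 'f) mexp" "('n, 'f) mexp"
  | Delete "('n, 'f) mexp" "'f set"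
  | Rename "'f \<Rightarrow> 'f" "('n, 'f) mexp"
  | Closure "('n, 'f) mexp"

text \<open>In the following, \<open>md\<close> assigns modules to module names.\<close>

primrec modular_expr ::
    "('c, 'f) sig \<Rightarrow> ('n \<Rightarrow> ('v, 'c, 'f) rule set) \<Rightarrow> ('n, 'f) mexp \<Rightarrow> bool" where
  "modular_expr sg md (Name n) \<longleftrightarrow> plain_module sg (md n) \<and> finite (md n)"
| "modular_expr sg md (Union E F) \<longleftrightarrow> modular_expr sg md E \<and> modular_expr sg md F"
| "modular_expr sg md (Delete E \<sigma>) \<longleftrightarrow> modular_expr sg md E \<and> \<sigma> \<subseteq> FS sg"
| "modular_expr sg md (Rename \<rho> E) \<longleftrightarrow> modular_expr sg md E \<and>
     \<rho> \<in> FS sg \<rightarrow> FS sg \<and> (\<forall>f \<in> FS sg. arF sg (\<rho> f) = arF sg f)"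
| "modular_expr sg md (Closure E) \<longleftrightarrow> modular_expr sg md E"

primrec denote ::
    "('c, 'f) sig \<Rightarrow> ('n \<Rightarrow> ('v, 'c, 'f) rule set) \<Rightarrow> ('n, 'f) mexp \<Rightarrow> ('v, 'c, 'f) rule set" where
  "denote sg md (Name n) = md n"
| "denote sg md (Union E F) = denote sg md E \<union> denote sg md F"
| "denote sg md (Delete E \<sigma>) = delete \<sigma> (denote sg md E)"
| "denote sg md (Rename \<rho> E) = map_rule_funs \<rho> ` denote sg md E"
| "denote sg md (Closure E) = closure sg (denote sg md E)"

section \<open>Structured modules\<close>

datatype ('n, 'f) xsym = Vis 'f | Lab "('n, 'f) mexp" 'f

text \<open>The signature extended by the labeled symbols, the labels being the modular expressions
  (among them, the module names).\<close>

definition ext_sig ::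
    "('c, 'f) sig \<Rightarrow> ('n \<Rightarrow> ('v, 'c, 'f) rule set) \<Rightarrow> ('c, ('n, 'f) xsym) sig" where
  "ext_sig sg md = \<lparr>
     DS = DS sg,
     FS = Vis ` FS sg \<union> {Lab E f | E f. modular_expr sg md E \<and> f \<in> FS sg},
     arD = arD sg,
     arF = (\<lambda>s. case s of Vis f \<Rightarrow> arF sg f | Lab E f \<Rightarrow> arF sg f)\<rparr>"

record ('v, 'c, 'n, 'f) smodule =
  visible :: "('v, 'c, ('n, 'f) xsym) rule set"
  bridge :: "('v, 'c, ('n, 'f) xsym) rule set"
  hidden :: "('v, 'c, ('n, 'f) xsym) rule set"

definition rule_funs :: "('v, 'c, 'f) rule \<Rightarrow> 'f set" where
  "rule_funs \<rho> = {head \<rho>} \<union> trm_funs (rhs \<rho>) \<union>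
     (\<Union>(a, b) \<in> conds \<rho>. trm_funs a \<union> trm_funs b)"

definition structured_module ::
    "('c, 'f) sig \<Rightarrow> ('n \<Rightarrow> ('v, 'c, 'f) rule set) \<Rightarrow> ('v, 'c, 'n, 'f) smodule \<Rightarrow> bool" where
  "structured_module sg md M \<longleftrightarrow>
     is_program (ext_sig sg md) (visible M \<union> bridge M \<union> hidden M) \<and>
     (\<forall>\<rho> \<in> visible M \<union> bridge M \<union> hidden M. rhs \<rho> \<noteq> Bot) \<and>
     (\<forall>\<rho> \<in> visible M. rule_funs \<rho> \<subseteq> range Vis) \<and>
     (\<forall>\<rho> \<in> hidden M. rule_funs \<rho> \<subseteq> range (case_prod Lab)) \<and>
     (\<forall>\<rho> \<in> bridge M. \<exists>f E g xs. distinct xs \<and> Lab E g \<in> exports (hidden M) \<and>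
        \<rho> = Rule (Vis f) (map CVar xs) (Fun (Lab E g) (map Var xs)) {})"

definition sexports :: "('v, 'c, 'n, 'f) smodule \<Rightarrow> 'f set" where
  "sexports M = {f. Vis f \<in> exports (visible M \<union> bridge M)}"

definition of_plain :: "('v, 'c, 'f) rule set \<Rightarrow> ('v, 'c, 'n, 'f) smodule" where
  "of_plain R = \<lparr>visible = map_rule_funs Vis ` R, bridge = {}, hidden = {}\<rparr>"

definition sunion ::
    "('v, 'c, 'n, 'f) smodule \<Rightarrow> ('v, 'c, 'n, 'f) smodule \<Rightarrow> ('v, 'c, 'n, 'f) smodule" where
  "sunion M N = \<lparr>visible = visible M \<union> visible N, bridge = bridge M \<union> bridge N,
     hidden = hidden M \<union> hidden N\<rparr>"

definition sdelete :: "'f set \<Rightarrow> ('v, 'c, 'n, 'f) smodule \<Rightarrow> ('v, 'c, 'n, 'f) smodule" where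
  "sdelete \<sigma> M = \<lparr>visible = delete (Vis ` \<sigma>) (visible M),
     bridge = delete (Vis ` \<sigma>) (bridge M), hidden = hidden M\<rparr>"

fun rename_vis :: "('f \<Rightarrow> 'f) \<Rightarrow> ('n, 'f) xsym \<Rightarrow> ('n, 'f) xsym" where
  "rename_vis \<rho> (Vis f) = Vis (\<rho> f)"
| "rename_vis \<rho> (Lab E f) = Lab E f"

definition srename :: "('f \<Rightarrow> 'f) \<Rightarrow> ('v, 'c, 'n, 'f) smodule \<Rightarrow> ('v, 'c, 'n, 'f) smodule" where
  "srename \<rho> M = \<lparr>visible = map_rule_funs (rename_vis \<rho>) ` visible M,
     bridge = map_rule_funs (rename_vis \<rho>) ` bridge M, hidden = hidden M\<rparr>"

fun tau :: "('n, 'f) mexp \<Rightarrow> ('n, 'f) xsym \<Rightarrow> ('n, 'f) xsym" where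
  "tau P (Vis f) = Lab P f"
| "tau P (Lab E f) = Lab E f"

definition bridge_rule ::
    "('c, 'f) sig \<Rightarrow> ('n, 'f) mexp \<Rightarrow> 'f \<Rightarrow> ('v, 'c, ('n, 'f) xsym) rule" where
  "bridge_rule sg P f = (let xs = map (fresh {}) [0..<arF sg f]
     in Rule (Vis f) (map CVar xs) (Fun (Lab P f) (map Var xs)) {})"

definition sclosure ::
    "('c, 'f) sig \<Rightarrow> ('n, 'f) mexp \<Rightarrow> ('v, 'c, 'n, 'f) smodule \<Rightarrow> ('v, 'c, 'n, 'f) smodule" where
  "sclosure sg P M = \<lparr>visible = {}, bridge = bridge_rule sg P ` sexports M,
     hidden = map_rule_funs (tau P) ` (visible M \<union> bridge M) \<union> hidden M\<rparr>"

primrec iota ::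
    "('c, 'f) sig \<Rightarrow> ('n \<Rightarrow> ('v, 'c, 'f) rule set) \<Rightarrow> ('n, 'f) mexp \<Rightarrow>
     ('v, 'c, 'n, 'f) smodule" where
  "iota sg md (Name n) = of_plain (md n)"
| "iota sg md (Union E F) = sunion (iota sg md E) (iota sg md F)"
| "iota sg md (Delete E \<sigma>) = sdelete \<sigma> (iota sg md E)"
| "iota sg md (Rename \<rho> E) = srename \<rho> (iota sg md E)"
| "iota sg md (Closure E) = sclosure sg E (iota sg md E)"

definition ext_alg :: "('v, 'c, 'f) alg \<Rightarrow> ('v, 'c, ('n, 'f) xsym) alg" where
  "ext_alg A = (\<lambda>s ts. case s of Vis f \<Rightarrow> A f ts | Lab E f \<Rightarrow> {CBot})"

definition restrict_alg :: "('v, 'c, ('n, 'f) xsym) alg \<Rightarrow> ('v, 'c, 'f) alg" where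
  "restrict_alg B = (\<lambda>f. B (Vis f))"

definition U_op ::
    "('c, 'f) sig \<Rightarrow> ('n \<Rightarrow> ('v, 'c, 'f) rule set) \<Rightarrow> ('v, 'c, 'n, 'f) smodule \<Rightarrow>
     ('v, 'c, 'f) alg \<Rightarrow> ('v, 'c, 'f) alg" where
  "U_op sg md M A = restrict_alg
     (T_op (ext_sig sg md) (visible M \<union> bridge M)
       (sup (T_omega (ext_sig sg md) (hidden M) bot_alg) (ext_alg A)))"

end

theory Submission
  imports Defs
begin

text \<open>Rules \<open>P.f(..) \<rightarrow> ..\<close> for a label \<open>P\<close> are the same in every representation in which they occur:
  they are the visible and bridge rules of \<open>\<iota>(P)\<close>, relabeled by \<open>\<tau>\<close>. So there is one algebra \<open>W\<close>
  (\<open>hidden_alg\<close>), interpreting \<open>P.f\<close> as \<open>f\<close> in the least fixpoint of \<open>T_P\<close>, that can replace the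
  semantics of the hidden rules of all representations simultaneously. With \<open>W\<close> for the hidden part,
  the theorem follows by induction on the expression, the hidden parts of the arguments of a union
  not interfering. In the case of a closure, both sides give the set of all \<open>r\<close> such that
  \<open>f(..) \<rightarrow> r\<close> is derivable, which is the least fixpoint of \<open>T_P\<close> at \<open>f\<close> by adequacy of the
  calculus. This fact in turn makes \<open>W\<close> a fixpoint of the hidden rules, and a well-founded induction
  on labels shows that it lies below their least fixpoint.\<close>

section \<open>The approximation order and evaluation\<close>

text \<open>An induction on the expression for the equation itself breaks at unions: the two
  arguments come with different hidden parts, and the least fixpoint of the joint hidden part is a
  third algebra, so the induction hypotheses interpret the labels differently. With one fixed
  interpretation of all labels they can be combined directly, and it is exchanged for the least
  fixpoint of the hidden part only once, at the end. This exchange is not an equality of algebras.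
  \<open>hidden_alg\<close> interprets every label, whereas the hidden part of \<open>E\<close> has
  rules only for the expressions closed inside \<open>E\<close>; moreover, algebras are
  unconstrained outside well-formed tuples. Hence the local monotonicity lemmas
  \<open>eval_mono_on\<close> and \<open>T_op_mono_on\<close>, which compare algebras only at
  well-formed tuples and at symbols from a set \<open>F\<close> containing those of the rules at
  hand. Closures are the other obstacle: their rules are instantiated with partial substitutions,
  while the least fixpoint is closed under total ones only. The joinability conditions built into
  \<open>crr\<close> bridge this gap.\<close>

lemma list_all2_mono_set2:
  "list_all2 P xs ys \<Longrightarrow> (\<And>x y. y \<in> set ys \<Longrightarrow> P x y \<Longrightarrow> Q x y) \<Longrightarrow> list_all2 Q xs ys"
  by (erule list.rel_mono_strong) blast

lemma list_all2_set1: "list_all2 P xs ys \<Longrightarrow> x \<in> set xs \<Longrightarrow> \<exists>y \<in> set ys. P x y"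
  by (induction rule: list_all2_induct) auto

lemma list_all2_const: "(\<And>y. y \<in> set ys \<Longrightarrow> P x y) \<Longrightarrow> list_all2 P (map (\<lambda>_. x) ys) ys"
  by (induction ys) auto

text \<open>Transitivity is one of the rules of the order, so inversion at a constructor takes an
  induction. In the transitive case the middle term is either \<open>CBot\<close>, which forces the
  lower term to be \<open>CBot\<close>, or has the same constructor, and then the other induction
  hypothesis applies.\<close>

lemma approx_Con_imp:
  "s \<sqsubseteq> t \<Longrightarrow> t = CCon c ts \<Longrightarrow> s = CBot \<or> (\<exists>ss. s = CCon c ss \<and> list_all2 (\<sqsubseteq>) ss ts)"
proof (induction arbitrary: c ts rule: approx.induct)
  case (approx_con ss ts c)
  then show ?case by (auto elim: list.rel_mono_strong)
next
  case (approx_refl t)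
  then show ?case by (auto intro: list.rel_refl approx.approx_refl)
next
  case (approx_trans s t u)
  from approx_trans.IH(2)[OF approx_trans.prems] show ?case
  proof
    assume "t = CBot"
    then show ?thesis
      using approx_size[OF approx_trans.hyps(1)] approx.approx_bot approx_antisym
        approx_trans.hyps(1) by blast
  next
    assume "\<exists>ss. t = CCon c ss \<and> list_all2 (\<sqsubseteq>) ss ts"
    then obtain ts' where "t = CCon c ts'" and ts': "list_all2 (\<sqsubseteq>) ts' ts" by auto
    with approx_trans.IH(1) have "s = CBot \<or> (\<exists>ss. s = CCon c ss \<and> list_all2 (\<sqsubseteq>) ss ts')"
      by blast
    then show ?thesis using list_all2_trans[OF _ _ ts', of "(\<sqsubseteq>)" "(\<sqsubseteq>)"] approx.approx_trans
      by blast
  qed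
qed auto

lemma approx_Con_iff:
  "s \<sqsubseteq> CCon c ts \<longleftrightarrow> s = CBot \<or> (\<exists>ss. s = CCon c ss \<and> list_all2 (\<sqsubseteq>) ss ts)"
  by (auto dest: approx_Con_imp[OF _ refl] intro: approx_bot approx_con)

lemma approx_Bot_iff [simp]: "s \<sqsubseteq> CBot \<longleftrightarrow> s = CBot"
  using approx_antisym approx_bot approx_refl by blast

lemma approx_Var_imp: "s \<sqsubseteq> t \<Longrightarrow> t = CVar x \<Longrightarrow> s = CBot \<or> s = CVar x"
  by (induction rule: approx.induct) auto

lemma approx_Var_iff: "s \<sqsubseteq> CVar x \<longleftrightarrow> s = CBot \<or> s = CVar x"
  by (auto dest: approx_Var_imp[OF _ refl] intro: approx_bot approx_refl)

lemma approx_list_refl [simp]: "list_all2 (\<sqsubseteq>) ts ts"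
  by (simp add: list.rel_refl approx_refl)

lemma approx_list_trans: "list_all2 (\<sqsubseteq>) ss ts \<Longrightarrow> list_all2 (\<sqsubseteq>) ts us \<Longrightarrow> list_all2 (\<sqsubseteq>) ss us"
  using list_all2_trans approx_trans by blast

section \<open>Well-formedness, totality and substitution of constructor terms\<close>

lemma wf_ct_approx: "wf_ct sg t \<Longrightarrow> s \<sqsubseteq> t \<Longrightarrow> wf_ct sg s"
proof (induction t arbitrary: s)
  case (CCon c ts)
  show ?case
  proof (cases "s = CBot")
    case False
    then obtain ss where ss: "s = CCon c ss" "list_all2 (\<sqsubseteq>) ss ts"
      using CCon.prems(2) by (auto simp: approx_Con_iff)
    have "wf_ct sg x" if "x \<in> set ss" for x
      using list_all2_set1[OF ss(2) that] CCon by auto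
    with ss CCon.prems(1) show ?thesis by (simp add: list_all2_lengthD)
  qed simp
qed (auto simp: approx_Var_iff)

text \<open>Nothing is left to refine where no \<open>CBot\<close> occurs: total terms are maximal.
  This is what turns joinability of constructor terms into equality.\<close>

lemma total_ct_approx: "total_ct s \<Longrightarrow> s \<sqsubseteq> t \<Longrightarrow> s = t"
proof (induction t arbitrary: s)
  case (CCon c ts)
  then obtain ss where ss: "s = CCon c ss" "list_all2 (\<sqsubseteq>) ss ts" by (auto simp: approx_Con_iff)
  have "list_all2 (=) ss ts"
    by (rule list.rel_mono_strong[OF ss(2)]) (use CCon ss(1) in auto)
  then show ?case using ss(1) by (simp add: list.rel_eq)
qed (auto simp: approx_Var_iff)

lemma approx_subst_ct: "s \<sqsubseteq> t \<Longrightarrow> subst_ct \<theta> s \<sqsubseteq> subst_ct \<theta> t"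
proof (induction t arbitrary: s)
  case (CCon c ts)
  have "list_all2 (\<lambda>s t. subst_ct \<theta> s \<sqsubseteq> subst_ct \<theta> t) ss ts" if "list_all2 (\<sqsubseteq>) ss ts" for ss
    using that by (rule list_all2_mono_set2) (use CCon.IH in auto)
  with CCon.prems show ?case
    by (auto simp: approx_Con_iff approx_bot list_all2_map1 list_all2_map2)
qed (auto simp: approx_Var_iff intro: approx.intros)

lemma wf_subst_ct: "\<theta> \<in> CSubst_bot sg \<Longrightarrow> wf_ct sg t \<Longrightarrow> wf_ct sg (subst_ct \<theta> t)"
  by (induction t) (auto simp: CSubst_bot_def CTerm_bot_def)

lemma total_subst_ct: "\<theta> \<in> CSubst sg \<Longrightarrow> total_ct t \<Longrightarrow> total_ct (subst_ct \<theta> t)"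
  by (induction t) (auto simp: CSubst_def CTerm_def)

lemma CSubst_imp_bot: "\<theta> \<in> CSubst sg \<Longrightarrow> \<theta> \<in> CSubst_bot sg"
  by (auto simp: CSubst_bot_def CSubst_def CTerm_bot_def CTerm_def)

lemma wf_emb [simp]: "wf_trm sg (emb t) \<longleftrightarrow> wf_ct sg t"
  by (induction t) auto

lemma wf_subst_trm: "\<theta> \<in> CSubst_bot sg \<Longrightarrow> wf_trm sg t \<Longrightarrow> wf_trm sg (subst_trm \<theta> t)"
  by (induction t) (auto simp: CSubst_bot_def CTerm_bot_def)

lemma subst_trm_emb: "subst_trm \<theta> (emb t) = emb (subst_ct \<theta> t)"
  by (induction t) auto

lemma subst_ct_comp: "subst_ct \<theta> (subst_ct \<sigma> t) = subst_ct (\<lambda>x. subst_ct \<theta> (\<sigma> x)) t"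
  by (induction t) auto

lemma subst_trm_comp: "subst_trm \<theta> (subst_trm \<sigma> t) = subst_trm (\<lambda>x. subst_ct \<theta> (\<sigma> x)) t"
  by (induction t) (auto simp: subst_trm_emb)

lemma subst_ct_cong: "(\<And>x. x \<in> ct_vars t \<Longrightarrow> \<theta> x = \<sigma> x) \<Longrightarrow> subst_ct \<theta> t = subst_ct \<sigma> t"
  by (induction t) auto

lemma subst_ct_id: "(\<And>x. x \<in> ct_vars t \<Longrightarrow> \<theta> x = CVar x) \<Longrightarrow> subst_ct \<theta> t = t"
  by (induction t) (auto intro: map_idI)

lemma emb_inj: "emb s = emb t \<Longrightarrow> s = t"
proof (induction s arbitrary: t)
  case CBot
  then show ?case by (cases t) auto
next
  case (CVar x)
  then show ?case by (cases t) auto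
next
  case (CCon c ss)
  then obtain ts where "t = CCon c ts" "map emb ss = (map emb ts :: ('a, 'b, 'c) trm list)"
    by (cases t) auto
  moreover from this(2) CCon.IH have "ss = ts"
    by (intro list.inj_map_strong[of ss ts emb emb]) auto
  ultimately show ?case by simp
qed

lemma emb_eq_Bot_iff [simp]: "emb t = Bot \<longleftrightarrow> t = CBot"
  by (cases t) auto

section \<open>Evaluation of terms in an algebra\<close>

lemma in_listset_map: "us \<in> listset (map g es) \<longleftrightarrow> list_all2 (\<lambda>u e. u \<in> g e) us es"
  by (induction es arbitrary: us) (auto simp: set_Cons_def list_all2_Cons2)

lemma eval_Con_iff:
  "t \<in> eval A \<eta> (Con c es) \<longleftrightarrow>
    (\<exists>us. list_all2 (\<lambda>u e. u \<in> eval A \<eta> e) us es \<and> t \<sqsubseteq> CCon c us)"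
  by (auto simp: in_listset_map down_def)

lemma eval_Fun_iff:
  "t \<in> eval A \<eta> (Fun f es) \<longleftrightarrow>
    (\<exists>us. list_all2 (\<lambda>u e. u \<in> eval A \<eta> e) us es \<and> t \<in> A f us)"
  by (auto simp: in_listset_map)

text \<open>The part of \<open>term_alg\<close> that keeps evaluation inside the carrier, so that
  function symbols are only ever called at well-formed tuples. It is preserved by joins at once,
  which makes it convenient for algebras glued from a hidden and a visible half.\<close>

definition typed_alg :: "('c, 'f) sig \<Rightarrow> ('v, 'c, 'f) alg \<Rightarrow> bool" where
  "typed_alg sg A \<longleftrightarrow> (\<forall>f \<in> FS sg. \<forall>ts \<in> tuples sg f. A f ts \<subseteq> CTerm_bot sg)"

lemma term_alg_typed: "term_alg sg A \<Longrightarrow> typed_alg sg A"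
  by (auto simp: term_alg_def typed_alg_def cone_def)

lemma eval_typed:
  assumes "typed_alg sg A" and "wf_trm sg e" and "u \<in> eval A CVar e"
  shows "wf_ct sg u"
  using assms(2,3)
proof (induction e arbitrary: u)
  case (Var x)
  then show ?case by (auto simp: down_def approx_Var_iff)
next
  case (Con c es)
  then obtain us where us: "list_all2 (\<lambda>u e. u \<in> eval A CVar e) us es" "u \<sqsubseteq> CCon c us"
    by (auto simp: in_listset_map down_def)
  have "wf_ct sg u" if "u \<in> set us" for u
    using list_all2_set1[OF us(1) that] Con.IH Con.prems(1) by auto
  then have "wf_ct sg (CCon c us)"
    using list_all2_lengthD[OF us(1)] Con.prems(1) by simp
  with us(2) show ?case using wf_ct_approx by blast
next
  case (Fun f es)
  then obtain us where us: "list_all2 (\<lambda>u e. u \<in> eval A CVar e) us es" "u \<in> A f us"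
    by (auto simp: in_listset_map)
  have "wf_ct sg u" if "u \<in> set us" for u
    using list_all2_set1[OF us(1) that] Fun.IH Fun.prems(1) by auto
  then have "us \<in> tuples sg f"
    using list_all2_lengthD[OF us(1)] Fun.prems(1) by (auto simp: tuples_def CTerm_bot_def)
  with us(2) assms(1) Fun.prems(1) show ?case by (auto simp: typed_alg_def CTerm_bot_def)
qed (auto simp: down_def)

lemma eval_list_tuples:
  assumes "typed_alg sg A" and "wf_trm sg (Fun f es)"
    and "list_all2 (\<lambda>u e. u \<in> eval A CVar e) us es"
  shows "us \<in> tuples sg f"
proof -
  have "wf_ct sg u" if "u \<in> set us" for u
    using list_all2_set1[OF assms(3) that] assms(2) eval_typed[OF assms(1)] by auto
  then show ?thesis
    using list_all2_lengthD[OF assms(3)] assms(2) by (auto simp: tuples_def CTerm_bot_def)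
qed

text \<open>Only the outermost symbol matters, so a case distinction replaces an induction: values
  of constructors are cones by definition, those of function symbols by
  \<open>term_alg\<close>.\<close>

lemma eval_down:
  assumes "term_alg sg A" and "wf_trm sg e" and "u \<in> eval A CVar e" and "s \<sqsubseteq> u"
  shows "s \<in> eval A CVar e"
  using assms(2-)
proof (cases e)
  case (Fun f es)
  with assms obtain us where us: "list_all2 (\<lambda>u e. u \<in> eval A CVar e) us es" "u \<in> A f us"
    by (auto simp: in_listset_map)
  have "us \<in> tuples sg f"
    using eval_list_tuples[OF term_alg_typed[OF assms(1)] _ us(1)] Fun assms(2) by blast
  with assms(1,2) Fun have "cone sg (A f us)" by (simp add: term_alg_def)
  with us(2) assms(4) have "s \<in> A f us" unfolding cone_def by blast
  with us(1) Fun show ?thesis by (auto simp: in_listset_map)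
next
  case (Con c es)
  with assms(3,4) show ?thesis by (auto simp: down_def) (blast intro: approx_trans)
qed (auto simp: down_def intro: approx_trans)

lemma eval_bot:
  assumes "term_alg sg A" and "wf_trm sg e"
  shows "CBot \<in> eval A CVar e"
  using assms(2)
proof (induction e)
  case (Con c es)
  then have "list_all2 (\<lambda>u e. u \<in> eval A CVar e) (map (\<lambda>_. CBot) es) es"
    by (intro list_all2_const) auto
  then show ?case unfolding eval_Con_iff using approx_bot by blast
next
  case (Fun f es)
  then have "list_all2 (\<lambda>u e. u \<in> eval A CVar e) (map (\<lambda>_. CBot) es) es"
    by (intro list_all2_const) auto
  then obtain us where us: "list_all2 (\<lambda>u e. u \<in> eval A CVar e) us es" by blast
  have "us \<in> tuples sg f"
    using eval_list_tuples[OF term_alg_typed[OF assms(1)] Fun.prems us] .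
  with assms(1) Fun.prems have "cone sg (A f us)" by (auto simp: term_alg_def)
  then have "CBot \<in> A f us" unfolding cone_def using approx_bot by blast
  with us show ?case unfolding eval_Fun_iff by blast
qed (auto simp: down_def approx_bot)

lemma eval_emb: "eval A CVar (emb t) = down t"
proof (induction t)
  case (CCon c ts)
  then have "us \<in> listset (map (eval A CVar \<circ> emb) ts) \<longleftrightarrow> list_all2 (\<sqsubseteq>) us ts" for us
    unfolding in_listset_map
    by (auto simp: down_def elim!: list_all2_mono_set2)
  then have "eval A CVar (emb (CCon c ts)) = (\<Union>us \<in> {us. list_all2 (\<sqsubseteq>) us ts}. down (CCon c us))"
    by auto
  also have "\<dots> = down (CCon c ts)"
    using approx_list_trans approx_list_refl[of ts] unfolding down_def approx_Con_iff by blast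
  finally show ?case .
qed auto

lemma eval_map_trm: "eval A \<eta> (map_trm id id h e) = eval (\<lambda>f. A (h f)) \<eta> e"
  by (induction e) (simp_all add: o_def cong: map_cong)

text \<open>Evaluating \<open>e\<close> consults the algebra only at symbols of \<open>e\<close>
  and, because the smaller algebra is typed, at well-formed tuples. The comparison of the two
  algebras can be restricted accordingly; \<open>eval_mono\<close> is the version for the global
  pointwise order.\<close>

lemma eval_mono_on:
  assumes "typed_alg sg A"
    and "\<And>f ts. f \<in> F \<Longrightarrow> f \<in> FS sg \<Longrightarrow> ts \<in> tuples sg f \<Longrightarrow> A f ts \<subseteq> B f ts"
    and "wf_trm sg e" and "trm_funs e \<subseteq> F"
  shows "eval A CVar e \<subseteq> eval B CVar e"
  using assms(3,4)
proof (induction e)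
  case (Con c es)
  have "list_all2 (\<lambda>u e. u \<in> eval B CVar e) us es"
    if "list_all2 (\<lambda>u e. u \<in> eval A CVar e) us es" for us
    using that by (rule list_all2_mono_set2) (use Con in \<open>auto simp: UN_subset_iff\<close>)
  then show ?case unfolding subset_iff eval_Con_iff by blast
next
  case (Fun f es)
  have "list_all2 (\<lambda>u e. u \<in> eval B CVar e) us es \<and> A f us \<subseteq> B f us"
    if us: "list_all2 (\<lambda>u e. u \<in> eval A CVar e) us es" for us
  proof
    show "list_all2 (\<lambda>u e. u \<in> eval B CVar e) us es"
      using us by (rule list_all2_mono_set2) (use Fun in \<open>auto simp: UN_subset_iff\<close>)
    show "A f us \<subseteq> B f us"
      using assms(2) eval_list_tuples[OF assms(1) Fun.prems(1) us] Fun.prems by auto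
  qed
  then show ?case unfolding subset_iff eval_Fun_iff by blast
qed auto

lemma eval_mono:
  assumes "A \<le> B"
  shows "eval A \<eta> e \<subseteq> eval B \<eta> e"
proof (induction e)
  case (Con c es)
  have "list_all2 (\<lambda>u e. u \<in> eval B \<eta> e) us es"
    if "list_all2 (\<lambda>u e. u \<in> eval A \<eta> e) us es" for us
    using that by (rule list_all2_mono_set2) (use Con in auto)
  then show ?case unfolding subset_iff eval_Con_iff by blast
next
  case (Fun f es)
  have "list_all2 (\<lambda>u e. u \<in> eval B \<eta> e) us es"
    if "list_all2 (\<lambda>u e. u \<in> eval A \<eta> e) us es" for us
    using that by (rule list_all2_mono_set2) (use Fun in auto)
  then show ?case using assms unfolding subset_iff eval_Fun_iff le_fun_def by blast
qed auto

text \<open>There are finitely many arguments, so the maximum of their stages serves all of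
  them.\<close>

lemma chain_list_all2:
  fixes B :: "nat \<Rightarrow> 'e \<Rightarrow> 'u set"
  assumes "\<And>e. e \<in> set es \<Longrightarrow> mono (\<lambda>n. B n e)"
    and "list_all2 (\<lambda>u e. u \<in> (\<Union>n. B n e)) us es"
  shows "\<exists>n. list_all2 (\<lambda>u e. u \<in> B n e) us es"
  using assms(2,1)
proof (induction rule: list_all2_induct)
  case (Cons u us e es)
  then obtain n m where n: "list_all2 (\<lambda>u e. u \<in> B n e) us es" and m: "u \<in> B m e" by auto
  have "list_all2 (\<lambda>u e. u \<in> B (max m n) e) us es"
    using n by (rule list_all2_mono_set2) (use Cons.prems monoD[of _ n "max m n"] in force)
  moreover have "u \<in> B (max m n) e"
    using m Cons.prems[of e] monoD[of _ m "max m n"] by force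
  ultimately show ?case by (intro exI[of _ "max m n"]) simp
qed simp

text \<open>Continuity: a value of a term depends on finitely many function values, each of which
  already appears at a finite stage of the chain. At a function symbol the stages of the arguments
  and of the call itself are joined by a maximum.\<close>

lemma eval_Sup_chain:
  assumes "mono (A :: nat \<Rightarrow> ('v, 'c, 'f) alg)"
  shows "eval (SUP n. A n) \<eta> e = (\<Union>n. eval (A n) \<eta> e)"
proof
  show "(\<Union>n. eval (A n) \<eta> e) \<subseteq> eval (SUP n. A n) \<eta> e"
    by (intro UN_least eval_mono SUP_upper) simp
  have mono: "mono (\<lambda>n. eval (A n) \<eta> e)" for e
    by (intro monoI eval_mono monoD[OF assms])
  have chain: "\<exists>n. list_all2 (\<lambda>u e. u \<in> eval (A n) \<eta> e) us es"
    if "list_all2 (\<lambda>u e. u \<in> eval (SUP n. A n) \<eta> e) us es"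
      and "\<And>e. e \<in> set es \<Longrightarrow> eval (SUP n. A n) \<eta> e \<subseteq> (\<Union>n. eval (A n) \<eta> e)" for us es
  proof (rule chain_list_all2[OF mono])
    show "list_all2 (\<lambda>u e. u \<in> (\<Union>n. eval (A n) \<eta> e)) us es"
      using that(1) by (rule list_all2_mono_set2) (use that(2) in blast)
  qed
  show "eval (SUP n. A n) \<eta> e \<subseteq> (\<Union>n. eval (A n) \<eta> e)"
  proof (induction e)
    case (Con c es)
    then show ?case using chain unfolding subset_iff UN_iff eval_Con_iff by blast
  next
    case (Fun f es)
    show ?case
    proof
      fix t assume "t \<in> eval (SUP n. A n) \<eta> (Fun f es)"
      then obtain us m where us: "list_all2 (\<lambda>u e. u \<in> eval (SUP n. A n) \<eta> e) us es"
        and t: "t \<in> A m f us"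
        unfolding eval_Fun_iff by auto
      then obtain n where n: "list_all2 (\<lambda>u e. u \<in> eval (A n) \<eta> e) us es"
        using chain Fun by blast
      have "list_all2 (\<lambda>u e. u \<in> eval (A (max m n)) \<eta> e) us es"
        using n by (rule list_all2_mono_set2) (use monoD[OF mono, of n "max m n"] in auto)
      moreover have "t \<in> A (max m n) f us"
        using t monoD[OF assms, of m "max m n"] by (auto simp: le_fun_def)
      ultimately show "t \<in> (\<Union>n. eval (A n) \<eta> (Fun f es))"
        unfolding UN_iff eval_Fun_iff by blast
    qed
  qed auto
qed

text \<open>Consistency is demanded of function symbols and propagates to all terms by structural
  induction. At a variable, the two elements \<open>CBot\<close> and \<open>CVar x\<close> of its
  cone are both sent into the cone of \<open>\<theta> x\<close>.\<close>

lemma eval_consistent: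
  assumes "typed_alg sg A" and "consistent sg A" and "\<theta> \<in> CSubst sg"
    and "wf_trm sg e" and "u \<in> eval A CVar e"
  shows "subst_ct \<theta> u \<in> eval A CVar (subst_trm \<theta> e)"
  using assms(4,5)
proof (induction e arbitrary: u)
  case (Var x)
  then show ?case by (auto simp: down_def eval_emb approx_Var_iff approx_bot approx_refl)
next
  case (Con c es)
  then obtain us where us: "list_all2 (\<lambda>u e. u \<in> eval A CVar e) us es" "u \<sqsubseteq> CCon c us"
    unfolding eval_Con_iff by blast
  have "list_all2 (\<lambda>u e. u \<in> eval A CVar e) (map (subst_ct \<theta>) us) (map (subst_trm \<theta>) es)"
    unfolding list_all2_map1 list_all2_map2 using us(1)
    by (rule list_all2_mono_set2) (use Con in auto)
  moreover have "subst_ct \<theta> u \<sqsubseteq> CCon c (map (subst_ct \<theta>) us)"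
    using approx_subst_ct[OF us(2), of \<theta>] by simp
  ultimately show ?case unfolding subst_trm.simps eval_Con_iff by blast
next
  case (Fun f es)
  then obtain us where us: "list_all2 (\<lambda>u e. u \<in> eval A CVar e) us es" "u \<in> A f us"
    unfolding eval_Fun_iff by blast
  have "list_all2 (\<lambda>u e. u \<in> eval A CVar e) (map (subst_ct \<theta>) us) (map (subst_trm \<theta>) es)"
    unfolding list_all2_map1 list_all2_map2 using us(1)
    by (rule list_all2_mono_set2) (use Fun in auto)
  moreover have "us \<in> tuples sg f" using eval_list_tuples[OF assms(1) Fun.prems(1) us(1)] .
  with us(2) assms(2,3) Fun.prems(1) have "subst_ct \<theta> u \<in> A f (map (subst_ct \<theta>) us)"
    unfolding consistent_def by (simp add: image_subset_iff)
  ultimately show ?case unfolding subst_trm.simps eval_Fun_iff by blast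
qed (auto simp: down_def)

section \<open>The operator of a program and its iterates\<close>

text \<open>Well-formedness of programs without left-linearity, which plays no role for the operator
  \<open>T_op\<close>.\<close>

definition admissible :: "('c, 'f) sig \<Rightarrow> ('v, 'c, 'f) rule set \<Rightarrow> bool" where
  "admissible sg R \<longleftrightarrow> (\<forall>f ts r C. Rule f ts r C \<in> R \<longrightarrow>
     f \<in> FS sg \<and> length ts = arF sg f \<and> (\<forall>t \<in> set ts. wf_ct sg t) \<and> wf_trm sg r \<and>
     finite C \<and> (\<forall>(a, b) \<in> C. wf_trm sg a \<and> wf_trm sg b))"

lemma admissible_program: "is_program sg R \<Longrightarrow> admissible sg R"
  by (fastforce simp: is_program_def admissible_def CTerm_def Term_bot_def Term_def)

lemma instancesI:
  assumes "\<theta> \<in> CSubst_bot sg" and "Rule f ss r C \<in> R"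
  shows "Rule f (map (subst_ct \<theta>) ss) (subst_trm \<theta> r)
    (map_prod (subst_trm \<theta>) (subst_trm \<theta>) ` C) \<in> instances sg R"
  unfolding instances_def using assms subst_rule.simps[of \<theta> f ss r C]
  by (metis (mono_tags, lifting) mem_Collect_eq)

lemma instancesE:
  assumes "Rule f ss r C \<in> instances sg R"
  obtains \<theta> ss' r' C' where "\<theta> \<in> CSubst_bot sg" and "Rule f ss' r' C' \<in> R"
    and "ss = map (subst_ct \<theta>) ss'" and "r = subst_trm \<theta> r'"
    and "C = map_prod (subst_trm \<theta>) (subst_trm \<theta>) ` C'"
proof -
  obtain \<theta> \<rho> where \<theta>: "\<theta> \<in> CSubst_bot sg" and \<rho>: "\<rho> \<in> R" "Rule f ss r C = subst_rule \<theta> \<rho>"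
    using assms by (auto simp: instances_def)
  with that show ?thesis by (cases \<rho>) auto
qed

lemma admissibleD:
  assumes "admissible sg R" and "Rule f ts r C \<in> R"
  shows "f \<in> FS sg" and "length ts = arF sg f" and "t \<in> set ts \<Longrightarrow> wf_ct sg t"
    and "wf_trm sg r" and "finite C" and "(a, b) \<in> C \<Longrightarrow> wf_trm sg a \<and> wf_trm sg b"
  using assms unfolding admissible_def by fast+

lemma admissible_instances:
  assumes "admissible sg R"
  shows "admissible sg (instances sg R)"
  unfolding admissible_def
proof (intro allI impI)
  fix f ts r C assume "Rule f ts r C \<in> instances sg R"
  then obtain \<theta> ts' r' C' where \<theta>: "\<theta> \<in> CSubst_bot sg" and rule: "Rule f ts' r' C' \<in> R"
    and *: "ts = map (subst_ct \<theta>) ts'" "r = subst_trm \<theta> r'"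
    "C = map_prod (subst_trm \<theta>) (subst_trm \<theta>) ` C'"
    by (rule instancesE)
  show "f \<in> FS sg \<and> length ts = arF sg f \<and> (\<forall>t \<in> set ts. wf_ct sg t) \<and> wf_trm sg r \<and>
     finite C \<and> (\<forall>(a, b) \<in> C. wf_trm sg a \<and> wf_trm sg b)"
    unfolding * using admissibleD[OF assms rule] wf_subst_ct[OF \<theta>] wf_subst_trm[OF \<theta>] by auto
qed

lemma instances_subst:
  assumes "Rule f ss r C \<in> instances sg R" and "\<theta> \<in> CSubst_bot sg"
  shows "Rule f (map (subst_ct \<theta>) ss) (subst_trm \<theta> r)
    (map_prod (subst_trm \<theta>) (subst_trm \<theta>) ` C) \<in> instances sg R"
proof -
  obtain \<sigma> ss' r' C' where \<sigma>: "\<sigma> \<in> CSubst_bot sg" and rule: "Rule f ss' r' C' \<in> R"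
    and *: "ss = map (subst_ct \<sigma>) ss'" "r = subst_trm \<sigma> r'"
    "C = map_prod (subst_trm \<sigma>) (subst_trm \<sigma>) ` C'"
    using assms(1) by (rule instancesE)
  have "(\<lambda>x. subst_ct \<theta> (\<sigma> x)) \<in> CSubst_bot sg"
    using \<sigma> wf_subst_ct[OF assms(2)] by (simp add: CSubst_bot_def CTerm_bot_def)
  from instancesI[OF this rule] show ?thesis
    unfolding * by (simp add: subst_ct_comp subst_trm_comp image_image map_prod_def
        case_prod_beta o_def)
qed

lemma T_op_iff:
  "t \<in> T_op sg R A f ts \<longleftrightarrow> t = CBot \<or> (\<exists>ss r C. Rule f ss r C \<in> instances sg R \<and>
     list_all2 (\<sqsubseteq>) ss ts \<and> models_id sg A C \<and> t \<in> eval A CVar r)"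
  by (auto simp: T_op_def)

lemma bot_in_T_op [simp]: "CBot \<in> T_op sg R A f ts"
  by (simp add: T_op_def)

lemma T_op_not_head:
  assumes "f \<notin> exports R"
  shows "T_op sg R A f ts = {CBot}"
proof -
  have "Rule f ss r C \<notin> instances sg R" for ss r C
    using assms by (force simp: exports_def elim: instancesE)
  then show ?thesis by (auto simp: T_op_iff)
qed

lemma models_id_mono: "A \<le> B \<Longrightarrow> models_id sg A C \<Longrightarrow> models_id sg B C"
  unfolding models_id_def using eval_mono[of A B CVar] by fastforce

lemma T_op_mono: "A \<le> B \<Longrightarrow> T_op sg R A \<le> T_op sg R B"
  by (intro le_funI subsetI) (use models_id_mono eval_mono[of A B CVar] in \<open>unfold T_op_iff, blast\<close>)

lemma trm_funs_emb [simp]: "trm_funs (emb t) = {}"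
  by (induction t) auto

lemma trm_funs_subst [simp]: "trm_funs (subst_trm \<theta> t) = trm_funs t"
  by (induction t) auto

text \<open>Substitution inserts constructor terms only, so an instance of a rule has the same
  function symbols as the rule. A bound \<open>F\<close> on the symbols of \<open>R\<close>
  therefore bounds those of all instances, and \<open>eval_mono_on\<close> applies to bodies and
  conditions.\<close>

lemma T_op_mono_on:
  assumes "typed_alg sg A" and "admissible sg R"
    and "\<And>f ts. f \<in> F \<Longrightarrow> f \<in> FS sg \<Longrightarrow> ts \<in> tuples sg f \<Longrightarrow> A f ts \<subseteq> B f ts"
    and "\<And>\<rho>. \<rho> \<in> R \<Longrightarrow> rule_funs \<rho> \<subseteq> F"
  shows "T_op sg R A f ts \<subseteq> T_op sg R B f ts"
proof -
  have le: "eval A CVar r \<subseteq> eval B CVar r" "models_id sg A C \<Longrightarrow> models_id sg B C"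
    if rule: "Rule f ss r C \<in> instances sg R" for ss r C
  proof -
    obtain \<theta> ss' r' C' where rule': "Rule f ss' r' C' \<in> R" and r: "r = subst_trm \<theta> r'"
      and C: "C = map_prod (subst_trm \<theta>) (subst_trm \<theta>) ` C'"
      using rule by (rule instancesE)
    have funs: "trm_funs r \<subseteq> F" "(a, b) \<in> C \<Longrightarrow> trm_funs a \<subseteq> F \<and> trm_funs b \<subseteq> F" for a b
    proof -
      show "trm_funs r \<subseteq> F" using assms(4)[OF rule'] by (simp add: rule_funs_def r)
      have "trm_funs a \<subseteq> F \<and> trm_funs b \<subseteq> F" if "(a, b) \<in> C'" for a b
        using assms(4)[OF rule'] UN_upper[OF that, of "\<lambda>(a, b). trm_funs a \<union> trm_funs b"]
        by (auto simp: rule_funs_def)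
      then show "(a, b) \<in> C \<Longrightarrow> trm_funs a \<subseteq> F \<and> trm_funs b \<subseteq> F"
        by (clarsimp simp: C)
    qed
    note wf = admissibleD[OF admissible_instances[OF assms(2)] rule]
    show "eval A CVar r \<subseteq> eval B CVar r"
      by (rule eval_mono_on[OF assms(1,3) wf(4) funs(1)])
    have "eval A CVar a \<subseteq> eval B CVar a \<and> eval A CVar b \<subseteq> eval B CVar b" if "(a, b) \<in> C" for a b
      using eval_mono_on[OF assms(1,3)] wf(6)[OF that] funs(2)[OF that] by simp
    then show "models_id sg A C \<Longrightarrow> models_id sg B C"
      unfolding models_id_def by fast
  qed
  then show ?thesis unfolding subset_iff T_op_iff by blast
qed

text \<open>The witness of a joinability statement must stay total after substitution, which holds
  because \<open>\<theta>\<close> is total. This is the point where consistency has to refer to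
  \<open>CSubst\<close> and not to \<open>CSubst_bot\<close>.\<close>

lemma models_id_subst:
  assumes "typed_alg sg A" and "consistent sg A" and "\<theta> \<in> CSubst sg"
    and "\<And>a b. (a, b) \<in> C \<Longrightarrow> wf_trm sg a \<and> wf_trm sg b" and "models_id sg A C"
  shows "models_id sg A (map_prod (subst_trm \<theta>) (subst_trm \<theta>) ` C)"
proof -
  have "eval A CVar (subst_trm \<theta> a) \<inter> eval A CVar (subst_trm \<theta> b) \<inter> CTerm sg \<noteq> {}"
    if "(a, b) \<in> C" for a b
  proof -
    obtain t where "t \<in> eval A CVar a" "t \<in> eval A CVar b" "t \<in> CTerm sg"
      using assms(5) \<open>(a, b) \<in> C\<close> unfolding models_id_def by blast
    then have "subst_ct \<theta> t \<in> eval A CVar (subst_trm \<theta> a) \<inter> eval A CVar (subst_trm \<theta> b) \<inter> CTerm sg"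
      using eval_consistent[OF assms(1-3)] assms(4)[OF that] total_subst_ct[OF assms(3)]
        wf_subst_ct[OF CSubst_imp_bot[OF assms(3)]] by (auto simp: CTerm_def)
    then show ?thesis by blast
  qed
  then show ?thesis by (auto simp: models_id_def)
qed

lemma T_op_term_alg:
  assumes R: "admissible sg R" and A: "term_alg sg A"
  shows "term_alg sg (T_op sg R A)"
proof -
  have wf: "wf_trm sg r" if "Rule f ss r C \<in> instances sg R" for f ss r C
    using admissibleD(4)[OF admissible_instances[OF R] that] .
  have "T_op sg R A f ts \<subseteq> CTerm_bot sg" for f ts
    using eval_typed[OF term_alg_typed[OF A] wf]
    by (auto simp: T_op_iff CTerm_bot_def)
  moreover have "s \<in> T_op sg R A f ts" if "t \<in> T_op sg R A f ts" "s \<sqsubseteq> t" for f ts s t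
  proof (cases "t = CBot")
    case True
    with that show ?thesis by simp
  next
    case False
    then show ?thesis using that eval_down[OF A wf] unfolding T_op_iff by blast
  qed
  ultimately have "cone sg (T_op sg R A f ts)" for f ts
    unfolding cone_def using bot_in_T_op[of sg R A f ts] by (metis empty_iff)
  moreover have "T_op sg R A f ss \<subseteq> T_op sg R A f ts" if "list_all2 (\<sqsubseteq>) ss ts" for f ss ts
    using approx_list_trans[OF _ that] unfolding subset_iff T_op_iff by blast
  ultimately show ?thesis by (auto simp: term_alg_def)
qed

text \<open>Substitutions compose, so applying \<open>\<theta>\<close> to the rule instance that
  produced a value gives a rule instance again; matching, conditions and body are all carried
  along.\<close>

lemma T_op_consistent:
  assumes R: "admissible sg R" and A: "term_alg sg A" "consistent sg A"
  shows "consistent sg (T_op sg R A)"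
  unfolding consistent_def
proof (intro ballI subsetI)
  fix f ts \<theta> u
  assume \<theta>: "\<theta> \<in> CSubst sg" and "u \<in> subst_ct \<theta> ` T_op sg R A f ts"
  then obtain t where t: "t \<in> T_op sg R A f ts" "u = subst_ct \<theta> t" by blast
  show "u \<in> T_op sg R A f (map (subst_ct \<theta>) ts)"
  proof (cases "t = CBot")
    case True
    then show ?thesis using t by simp
  next
    case False
    then obtain ss r C where rule: "Rule f ss r C \<in> instances sg R" and ss: "list_all2 (\<sqsubseteq>) ss ts"
      and C: "models_id sg A C" and r: "t \<in> eval A CVar r"
      using t by (auto simp: T_op_iff)
    note wf = admissibleD(4,6)[OF admissible_instances[OF R] rule]
    have "u \<in> eval A CVar (subst_trm \<theta> r)"
      using eval_consistent[OF term_alg_typed[OF A(1)] A(2) \<theta> wf(1) r] t by simp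
    moreover have "models_id sg A (map_prod (subst_trm \<theta>) (subst_trm \<theta>) ` C)"
      using models_id_subst[OF term_alg_typed[OF A(1)] A(2) \<theta> wf(2) C] by blast
    moreover have "list_all2 (\<sqsubseteq>) (map (subst_ct \<theta>) ss) (map (subst_ct \<theta>) ts)"
      unfolding list_all2_map1 list_all2_map2 using ss
      by (rule list_all2_mono_set2) (rule approx_subst_ct)
    ultimately show ?thesis
      using instances_subst[OF rule CSubst_imp_bot[OF \<theta>]] unfolding T_op_iff by blast
  qed
qed

section \<open>Finite iterates and the least fixpoint\<close>

abbreviation approximant ::
    "('c, 'f) sig \<Rightarrow> ('v, 'c, 'f) rule set \<Rightarrow> nat \<Rightarrow> ('v, 'c, 'f) alg" where
  "approximant sg R n \<equiv> (T_op sg R ^^ n) bot_alg"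

lemma mono_approximant: "mono (approximant sg R)"
proof -
  have "bot_alg \<le> T_op sg R bot_alg" by (auto simp: bot_alg_def le_fun_def)
  then have "approximant sg R n \<le> approximant sg R (Suc n)" for n
    by (induction n) (auto intro: T_op_mono)
  then show ?thesis by (auto simp: mono_iff_le_Suc)
qed

lemma approximant_CTAlg:
  assumes "admissible sg R"
  shows "term_alg sg (approximant sg R n) \<and> consistent sg (approximant sg R n)"
proof (induction n)
  case 0
  show ?case by (auto simp: bot_alg_def term_alg_def cone_def CTerm_bot_def consistent_def)
next
  case (Suc n)
  then show ?case using T_op_term_alg[OF assms] T_op_consistent[OF assms] by simp
qed

lemma T_omega_apply: "T_omega sg R A f ts = (\<Union>n. (T_op sg R ^^ n) A f ts)"
  by (simp add: T_omega_def image_image)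

lemma cone_UN:
  assumes "\<And>n :: nat. cone sg (K n)"
  shows "cone sg (\<Union>n. K n)"
  unfolding cone_def
proof (intro conjI ballI allI impI)
  show "(\<Union>n. K n) \<noteq> {}" "(\<Union>n. K n) \<subseteq> CTerm_bot sg"
    using assms by (auto simp: cone_def)
  show "s \<in> (\<Union>n. K n)" if "t \<in> (\<Union>n. K n)" and "s \<sqsubseteq> t" for s t
    using that assms unfolding cone_def by blast
qed

lemma T_omega_term_alg:
  assumes "admissible sg R"
  shows "term_alg sg (T_omega sg R bot_alg)"
proof -
  have A: "term_alg sg (approximant sg R n)" for n
    using approximant_CTAlg[OF assms] by blast
  show ?thesis
    unfolding term_alg_def T_omega_apply
  proof (intro ballI conjI impI)
    show "cone sg (\<Union>n. approximant sg R n f ts)" if "f \<in> FS sg" "ts \<in> tuples sg f" for f ts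
      using A that by (intro cone_UN) (simp add: term_alg_def)
    show "(\<Union>n. approximant sg R n f ss) \<subseteq> (\<Union>n. approximant sg R n f ts)"
      if "f \<in> FS sg" "ss \<in> tuples sg f" "ts \<in> tuples sg f" "list_all2 (\<sqsubseteq>) ss ts" for f ss ts
      using A that by (intro UN_mono) (simp_all add: term_alg_def)
  qed
qed

lemma T_omega_consistent:
  assumes "admissible sg R"
  shows "consistent sg (T_omega sg R bot_alg)"
proof -
  have A: "consistent sg (approximant sg R n)" for n
    using approximant_CTAlg[OF assms] by blast
  show ?thesis
    unfolding consistent_def T_omega_apply image_UN
    using A by (intro ballI UN_mono) (simp_all add: consistent_def)
qed

lemma bot_in_T_omega [simp]: "CBot \<in> T_omega sg R bot_alg f ts"
  unfolding T_omega_apply by (rule UN_I[of 0]) (auto simp: bot_alg_def)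

lemma T_omega_not_head: "f \<notin> exports R \<Longrightarrow> T_omega sg R bot_alg f ts = {CBot}"
proof -
  assume "f \<notin> exports R"
  then have "approximant sg R n f ts = {CBot}" for n
    by (cases n) (auto simp: bot_alg_def T_op_not_head)
  then show ?thesis by (simp add: T_omega_apply)
qed

lemma eval_T_omega: "eval (T_omega sg R bot_alg) \<eta> e = (\<Union>n. eval (approximant sg R n) \<eta> e)"
  unfolding T_omega_def by (rule eval_Sup_chain[OF mono_approximant])

text \<open>Each joinability statement is witnessed by one term, found at one stage for the left
  side and at another for the right side. Since the condition is finite, a maximum over all these
  stages exists.\<close>

lemma models_id_T_omega:
  assumes "finite C" and "models_id sg (T_omega sg R bot_alg) C"
  shows "\<exists>n. models_id sg (approximant sg R n) C"
  using assms
proof (induction C)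
  case empty
  then show ?case by (simp add: models_id_def)
next
  case (insert p C)
  obtain a b where p: "p = (a, b)" by force
  obtain n where n: "models_id sg (approximant sg R n) C"
    using insert by (auto simp: models_id_def)
  obtain t where t: "t \<in> eval (T_omega sg R bot_alg) CVar a" "t \<in> eval (T_omega sg R bot_alg) CVar b"
    "t \<in> CTerm sg"
    using insert.prems p by (auto simp: models_id_def)
  obtain i j where ij: "t \<in> eval (approximant sg R i) CVar a" "t \<in> eval (approximant sg R j) CVar b"
    using t by (auto simp: eval_T_omega)
  let ?k = "max n (max i j)"
  have le: "approximant sg R n \<le> approximant sg R ?k" "approximant sg R i \<le> approximant sg R ?k"
    "approximant sg R j \<le> approximant sg R ?k"
    using monoD[OF mono_approximant, of _ ?k sg R] by (meson max.cobounded1 max.coboundedI2 max.cobounded2)+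
  have "t \<in> eval (approximant sg R ?k) CVar a \<inter> eval (approximant sg R ?k) CVar b"
    using eval_mono[OF le(2)] eval_mono[OF le(3)] ij by blast
  with t(3) models_id_mono[OF le(1) n] have "models_id sg (approximant sg R ?k) (insert p C)"
    unfolding models_id_def p by blast
  then show ?case by blast
qed

text \<open>This step needs the conditions of the rules to be finite.\<close>

lemma T_omega_prefixpoint:
  assumes "admissible sg R"
  shows "T_op sg R (T_omega sg R bot_alg) f ts \<subseteq> T_omega sg R bot_alg f ts"
proof
  fix t assume t: "t \<in> T_op sg R (T_omega sg R bot_alg) f ts"
  show "t \<in> T_omega sg R bot_alg f ts"
  proof (cases "t = CBot")
    case False
    then obtain ss r C where rule: "Rule f ss r C \<in> instances sg R" and ss: "list_all2 (\<sqsubseteq>) ss ts"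
      and C: "models_id sg (T_omega sg R bot_alg) C" and r: "t \<in> eval (T_omega sg R bot_alg) CVar r"
      using t by (auto simp: T_op_iff)
    have "finite C" using admissibleD(5)[OF admissible_instances[OF assms] rule] .
    then obtain n where n: "models_id sg (approximant sg R n) C" using C models_id_T_omega by blast
    obtain m where m: "t \<in> eval (approximant sg R m) CVar r" using r by (auto simp: eval_T_omega)
    have "models_id sg (approximant sg R (max m n)) C" "t \<in> eval (approximant sg R (max m n)) CVar r"
      using models_id_mono[OF monoD[OF mono_approximant] n, of "max m n"]
        eval_mono[OF monoD[OF mono_approximant], of m "max m n"] m by force+
    then have "t \<in> approximant sg R (Suc (max m n)) f ts"
      using rule ss by (auto simp: T_op_iff)
    then show ?thesis unfolding T_omega_apply by blast
  qed simp
qed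

section \<open>Adequacy of the calculus\<close>

lemma list_all2_flip: "list_all2 P xs ys \<Longrightarrow> list_all2 (\<lambda>y x. P x y) ys xs"
  by (induction rule: list_all2_induct) auto

lemma list_all2_ex_map:
  "list_all2 (\<lambda>e t. \<exists>u. t = g u \<and> Q u e) es ts \<Longrightarrow> \<exists>us. ts = map g us \<and> list_all2 Q us es"
proof (induction rule: list_all2_induct)
  case (Cons e es t ts)
  then obtain u us where "t = g u" "Q u e" "ts = map g us" "list_all2 Q us es" by auto
  then show ?case by (intro exI[of _ "u # us"]) simp
qed simp

lemma eval_list_down:
  assumes "term_alg sg A" and "\<And>e. e \<in> set es \<Longrightarrow> wf_trm sg e" and "list_all2 (\<sqsubseteq>) ss us"
    and "list_all2 (\<lambda>u e. u \<in> eval A CVar e) us es"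
  shows "list_all2 (\<lambda>s e. s \<in> eval A CVar e) ss es"
proof (rule list_all2_trans[OF _ assms(3)])
  show "list_all2 (\<lambda>u e. wf_trm sg e \<and> u \<in> eval A CVar e) us es"
    using assms(4) by (rule list_all2_mono_set2) (use assms(2) in blast)
qed (use eval_down[OF assms(1)] in blast)

text \<open>Soundness, by induction on derivations. Formulas admit arbitrary terms on the right of a
  reduction, so the fact that only embedded constructor terms are derivable there is proved along.
  At \<open>OR\<close> the fixpoint absorbs one more application of a rule, by
  \<open>T_omega_prefixpoint\<close>.\<close>

lemma crwl_imp_eval:
  assumes R: "admissible sg R" and "crwl sg R \<phi>"
  shows "case \<phi> of
      e \<rightarrow>\<^sub>r t \<Rightarrow> \<exists>u. t = emb u \<and> u \<in> eval (T_omega sg R bot_alg) CVar e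
    | a \<bowtie> b \<Rightarrow> eval (T_omega sg R bot_alg) CVar a \<inter> eval (T_omega sg R bot_alg) CVar b \<inter>
        CTerm sg \<noteq> {}"
  using assms(2)
proof (induction rule: crwl.induct)
  case (Bo e)
  then have "CBot \<in> eval (T_omega sg R bot_alg) CVar e"
    using eval_bot[OF T_omega_term_alg[OF R]] by (simp add: Term_bot_def)
  moreover have "Bot = emb CBot" by simp
  ultimately show ?case unfolding formula.case by blast
next
  case (RR_var x)
  have "Var x = emb (CVar x)" "CVar x \<in> eval (T_omega sg R bot_alg) CVar (Var x)"
    by (simp_all add: down_def approx_refl)
  then show ?case unfolding formula.case by blast
next
  case (RR_con c)
  have "Con c [] = emb (CCon c [])" "CCon c [] \<in> eval (T_omega sg R bot_alg) CVar (Con c [])"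
    by (simp_all add: down_def approx_refl)
  then show ?case unfolding formula.case by blast
next
  case (DC c es ts)
  have "list_all2 (\<lambda>e t. \<exists>u. t = emb u \<and> u \<in> eval (T_omega sg R bot_alg) CVar e) es ts"
    using DC.IH by (rule list_all2_mono_set2) simp
  from list_all2_ex_map[OF this] obtain us where "ts = map emb us"
    and us: "list_all2 (\<lambda>u e. u \<in> eval (T_omega sg R bot_alg) CVar e) us es"
    by blast
  then have "Con c ts = emb (CCon c us)" by simp
  moreover have "CCon c us \<in> eval (T_omega sg R bot_alg) CVar (Con c es)"
    using us approx_refl unfolding eval_Con_iff by blast
  ultimately show ?case unfolding formula.case by blast
next
  case (OR f ss r C es t)
  have "list_all2 (\<lambda>e s. \<exists>u. s = id u \<and> u \<in> eval (T_omega sg R bot_alg) CVar e) es ss"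
    using OR.IH(1) by (rule list_all2_mono_set2) (auto dest: emb_inj)
  from list_all2_ex_map[OF this]
  have ss: "list_all2 (\<lambda>u e. u \<in> eval (T_omega sg R bot_alg) CVar e) ss es"
    by simp
  obtain u where u: "t = emb u" "u \<in> eval (T_omega sg R bot_alg) CVar r"
    using OR.IH(3) by auto
  have "models_id sg (T_omega sg R bot_alg) C"
    using OR.IH(2) unfolding models_id_def by auto
  then have "u \<in> T_op sg R (T_omega sg R bot_alg) f ss"
    using OR.hyps(1) u(2) unfolding T_op_iff by (blast intro: approx_list_refl)
  then have "u \<in> T_omega sg R bot_alg f ss"
    using T_omega_prefixpoint[OF R] by blast
  with ss have "u \<in> eval (T_omega sg R bot_alg) CVar (Fun f es)"
    unfolding eval_Fun_iff by blast
  with u(1) show ?case unfolding formula.case by blast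
next
  case (Jo t a b)
  then show ?case by (auto dest!: emb_inj)
qed

lemma crwl_Bot: "wf_trm sg e \<Longrightarrow> crwl sg R (e \<rightarrow>\<^sub>r Bot)"
  by (simp add: crwl.Bo Term_bot_def)

text \<open>The structural half of completeness, separated from the induction on stages:
  \<open>step\<close> packs what the latter supplies at a function symbol, namely that every proper
  value of \<open>A\<close> is produced by a rule instance whose conditions and body are already
  derivable.\<close>

lemma eval_imp_crwl:
  assumes A: "term_alg sg A"
    and step: "\<And>f us t. t \<in> A f us \<Longrightarrow> t \<noteq> CBot \<Longrightarrow> \<exists>ss r C. Rule f ss r C \<in> instances sg R \<and>
      list_all2 (\<sqsubseteq>) ss us \<and> (\<forall>a b. (a, b) \<in> C \<longrightarrow> crwl sg R (a \<bowtie> b)) \<and> crwl sg R (r \<rightarrow>\<^sub>r emb t)"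
    and "wf_trm sg e" and "t \<in> eval A CVar e"
  shows "crwl sg R (e \<rightarrow>\<^sub>r emb t)"
  using assms(3,4)
proof (induction e arbitrary: t)
  case Bot
  then show ?case by (simp add: down_def crwl_Bot)
next
  case (Var x)
  then have "t = CBot \<or> t = CVar x" by (simp add: down_def approx_Var_iff)
  with Var.prems(1) show ?case by (metis crwl_Bot crwl.RR_var emb.simps(1,2))
next
  case (Con c es)
  obtain us where us: "list_all2 (\<lambda>u e. u \<in> eval A CVar e) us es" "t \<sqsubseteq> CCon c us"
    using Con.prems(2) unfolding eval_Con_iff by blast
  show ?case
  proof (cases "t = CBot")
    case True
    with Con.prems(1) show ?thesis by (simp add: crwl_Bot)
  next
    case False
    then obtain ts where t: "t = CCon c ts" and ts: "list_all2 (\<sqsubseteq>) ts us"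
      using us(2) by (auto simp: approx_Con_iff)
    have "list_all2 (\<lambda>u e. u \<in> eval A CVar e) ts es"
      using eval_list_down[OF A _ ts us(1)] Con.prems(1) by simp
    then have "list_all2 (\<lambda>u e. crwl sg R (e \<rightarrow>\<^sub>r emb u)) ts es"
      by (rule list_all2_mono_set2) (use Con.IH Con.prems(1) in auto)
    then have "list_all2 (\<lambda>e t. crwl sg R (e \<rightarrow>\<^sub>r t)) es (map emb ts)"
      unfolding list_all2_map2 by (rule list_all2_flip)
    then show ?thesis using Con.prems(1) t by (simp add: crwl.DC)
  qed
next
  case (Fun f es)
  obtain us where us: "list_all2 (\<lambda>u e. u \<in> eval A CVar e) us es" "t \<in> A f us"
    using Fun.prems(2) unfolding eval_Fun_iff by blast
  show ?case
  proof (cases "t = CBot")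
    case True
    with Fun.prems(1) show ?thesis by (simp add: crwl_Bot)
  next
    case False
    from step[OF us(2) this] obtain ss r C where rule: "Rule f ss r C \<in> instances sg R"
      and ss: "list_all2 (\<sqsubseteq>) ss us" and C: "\<forall>a b. (a, b) \<in> C \<longrightarrow> crwl sg R (a \<bowtie> b)"
      and r: "crwl sg R (r \<rightarrow>\<^sub>r emb t)"
      by blast
    \<comment> \<open>\<open>OR\<close> wants the arguments to reduce exactly to the tuple
      \<open>ss\<close> of the instance, while the evaluation passed through the larger tuple
      \<open>us\<close>. Downward closure of evaluation closes the gap.\<close>
    have "list_all2 (\<lambda>u e. u \<in> eval A CVar e) ss es"
      using eval_list_down[OF A _ ss us(1)] Fun.prems(1) by simp
    then have "list_all2 (\<lambda>u e. crwl sg R (e \<rightarrow>\<^sub>r emb u)) ss es"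
      by (rule list_all2_mono_set2) (use Fun.IH Fun.prems(1) in auto)
    then have "list_all2 (\<lambda>e t. crwl sg R (e \<rightarrow>\<^sub>r emb t)) es ss"
      by (rule list_all2_flip)
    with crwl.OR[OF rule _ C r] False show ?thesis by simp
  qed
qed

lemma T_omega_imp_crwl:
  assumes R: "admissible sg R" and "wf_trm sg e" and "t \<in> eval (T_omega sg R bot_alg) CVar e"
  shows "crwl sg R (e \<rightarrow>\<^sub>r emb t)"
proof -
  have "crwl sg R (e \<rightarrow>\<^sub>r emb t)" if "wf_trm sg e" "t \<in> eval (approximant sg R n) CVar e" for n e t
    using that
  proof (induction n arbitrary: e t)
    \<comment> \<open>\<open>bot_alg\<close> has no value other than \<open>CBot\<close>, so the
      \<open>step\<close> premise is vacuous.\<close>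
    case 0
    then show ?case
      using eval_imp_crwl[OF approximant_CTAlg[OF R, of 0, THEN conjunct1]]
      by (simp add: bot_alg_def)
  next
    case (Suc n)
    show ?case
    proof (rule eval_imp_crwl[OF _ _ Suc.prems])
      show "term_alg sg (approximant sg R (Suc n))" using approximant_CTAlg[OF R] by blast
      fix f us t
      assume "t \<in> approximant sg R (Suc n) f us" "t \<noteq> CBot"
      then obtain ss r C where rule: "Rule f ss r C \<in> instances sg R" and ss: "list_all2 (\<sqsubseteq>) ss us"
        and C: "models_id sg (approximant sg R n) C" and r: "t \<in> eval (approximant sg R n) CVar r"
        unfolding funpow.simps o_apply T_op_iff by blast
      note wf = admissibleD(4,6)[OF admissible_instances[OF R] rule]
      have "crwl sg R (a \<bowtie> b)" if ab: "(a, b) \<in> C" for a b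
      proof -
        obtain u where u: "u \<in> CTerm sg" "u \<in> eval (approximant sg R n) CVar a"
          "u \<in> eval (approximant sg R n) CVar b"
          using C ab unfolding models_id_def by fast
        show ?thesis
          by (rule crwl.Jo[OF u(1)]) (use wf(2)[OF ab] Suc.IH u in auto)
      qed
      with rule ss Suc.IH[OF wf(1) r]
      show "\<exists>ss r C. Rule f ss r C \<in> instances sg R \<and> list_all2 (\<sqsubseteq>) ss us \<and>
        (\<forall>a b. (a, b) \<in> C \<longrightarrow> crwl sg R (a \<bowtie> b)) \<and> crwl sg R (r \<rightarrow>\<^sub>r emb t)"
        by blast
    qed
  qed
  with assms(2,3) show ?thesis by (auto simp: eval_T_omega)
qed

text \<open>Adequacy in the form that closures use. Constructor terms evaluate to their cones, so
  the call may receive any tuple below \<open>ts\<close>; monotonicity of the fixpoint makes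
  \<open>ts\<close> itself the best one.\<close>

lemma crwl_Fun_iff:
  assumes R: "admissible sg R" and f: "f \<in> FS sg" and ts: "ts \<in> tuples sg f"
  shows "crwl sg R (Fun f (map emb ts) \<rightarrow>\<^sub>r emb r) \<longleftrightarrow> r \<in> T_omega sg R bot_alg f ts"
proof
  have wf: "wf_trm sg (Fun f (map emb ts))"
    using f ts by (auto simp: tuples_def CTerm_bot_def)
  note A = T_omega_term_alg[OF R]
  have args: "list_all2 (\<lambda>u e. u \<in> eval (T_omega sg R bot_alg) CVar e) us (map emb ts) \<longleftrightarrow>
    list_all2 (\<sqsubseteq>) us ts" for us
    by (simp add: list_all2_map2 eval_emb down_def)
  {
    assume "crwl sg R (Fun f (map emb ts) \<rightarrow>\<^sub>r emb r)"
    from crwl_imp_eval[OF R this]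
    have "r \<in> eval (T_omega sg R bot_alg) CVar (Fun f (map emb ts))"
      by (auto simp del: eval.simps dest!: emb_inj)
    then obtain us where us: "list_all2 (\<lambda>u e. u \<in> eval (T_omega sg R bot_alg) CVar e) us (map emb ts)"
      "r \<in> T_omega sg R bot_alg f us"
      unfolding eval_Fun_iff by blast
    have "us \<in> tuples sg f"
      using eval_list_tuples[OF term_alg_typed[OF A] wf us(1)] .
    then have "T_omega sg R bot_alg f us \<subseteq> T_omega sg R bot_alg f ts"
      using A f ts us(1) unfolding args term_alg_def by blast
    with us(2) show "r \<in> T_omega sg R bot_alg f ts" by blast
  }
  assume "r \<in> T_omega sg R bot_alg f ts"
  then have "r \<in> eval (T_omega sg R bot_alg) CVar (Fun f (map emb ts))"
    using args approx_list_refl unfolding eval_Fun_iff by blast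
  then show "crwl sg R (Fun f (map emb ts) \<rightarrow>\<^sub>r emb r)"
    by (rule T_omega_imp_crwl[OF R wf])
qed

section \<open>The operator of a closure\<close>

lemma fresh_spec:
  assumes "infinite (UNIV :: 'v set)" and "finite (V :: 'v set)"
  shows "inj (fresh V) \<and> range (fresh V) \<inter> V = {}"
proof -
  have "infinite (- V)" using assms by (metis finite_Un Compl_partition2)
  then obtain \<nu> :: "nat \<Rightarrow> 'v" where "inj \<nu>" "range \<nu> \<subseteq> - V"
    using infinite_countable_subset by blast
  then have "\<exists>\<nu> :: nat \<Rightarrow> 'v. inj \<nu> \<and> range \<nu> \<inter> V = {}" by blast
  then show ?thesis unfolding fresh_def by (rule someI_ex)
qed

section \<open>Linearization of argument tuples\<close>

lemma finite_ct_vars [simp]: "finite (ct_vars t)"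
  by (induction t) auto

lemma set_var_occs [simp]: "set (var_occs t) = ct_vars t"
  by (induction t) auto

lemma lin_wf:
  "lin_ct \<nu> t st = (t', st') \<Longrightarrow> wf_ct sg t \<Longrightarrow> wf_ct sg t'"
  "lin_cts \<nu> ts st = (ts', st') \<Longrightarrow> (\<forall>t \<in> set ts. wf_ct sg t) \<Longrightarrow>
    length ts' = length ts \<and> (\<forall>t \<in> set ts'. wf_ct sg t)"
  by (induction \<nu> t st and \<nu> ts st arbitrary: t' st' and ts' st' rule: lin_ct_lin_cts.induct)
    (auto split: prod.splits if_splits)

lemma count_list_pos: "0 < count_list xs x \<longleftrightarrow> x \<in> set xs"
  using count_list_0_iff[of xs x] by auto

text \<open>A variable is recorded in the set of pairs when it is met a second time, be it inside
  the term or because the incoming state already knew it. \<open>crr\<close> has no explicit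
  condition of a repeated variable with itself unless it occurs in the right-hand side, so totality
  there is read off from these pairs.\<close>

lemma lin_state:
  fixes t :: "('v, 'c) ct" and ts :: "('v, 'c) ct list"
  shows "lin_ct \<nu> t st = (t', st') \<Longrightarrow>
    fst st' = fst st \<union> ct_vars t \<and> snd (snd st) \<subseteq> snd (snd st') \<and>
    (finite (snd (snd st)) \<longrightarrow> finite (snd (snd st'))) \<and>
    (\<forall>x. x \<in> fst st \<and> x \<in> ct_vars t \<or> count_list (var_occs t) x \<ge> 2 \<longrightarrow> x \<in> fst ` snd (snd st'))"
  and "lin_cts \<nu> ts st = (ts', st') \<Longrightarrow>
    fst st' = fst st \<union> \<Union> (ct_vars ` set ts) \<and> snd (snd st) \<subseteq> snd (snd st') \<and>
    (finite (snd (snd st)) \<longrightarrow> finite (snd (snd st'))) \<and>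
    (\<forall>x. x \<in> fst st \<and> x \<in> \<Union> (ct_vars ` set ts) \<or>
      count_list (concat (map var_occs ts)) x \<ge> 2 \<longrightarrow> x \<in> fst ` snd (snd st'))"
proof (induction \<nu> t st and \<nu> ts st arbitrary: t' st' and ts' st' rule: lin_ct_lin_cts.induct)
  case (5 \<nu> t ts st)
  obtain t1 st1 where 1: "lin_ct \<nu> t st = (t1, st1)" by (meson surj_pair)
  obtain ts2 st2 where 2: "lin_cts \<nu> ts st1 = (ts2, st2)" by (meson surj_pair)
  have st': "st' = st2" using 5(3) 1 2 by simp
  have S1: "fst st1 = fst st \<union> ct_vars t" and J1: "snd (snd st) \<subseteq> snd (snd st1)"
    and fin1: "finite (snd (snd st)) \<Longrightarrow> finite (snd (snd st1))"
    and dup1: "\<And>x. x \<in> fst st \<and> x \<in> ct_vars t \<or> count_list (var_occs t) x \<ge> 2 \<Longrightarrow>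
      x \<in> fst ` snd (snd st1)"
    using 5(1)[OF 1] by blast+
  have S2: "fst st2 = fst st1 \<union> \<Union> (ct_vars ` set ts)" and J2: "snd (snd st1) \<subseteq> snd (snd st2)"
    and fin2: "finite (snd (snd st1)) \<Longrightarrow> finite (snd (snd st2))"
    and dup2: "\<And>x. x \<in> fst st1 \<and> x \<in> \<Union> (ct_vars ` set ts) \<or>
      count_list (concat (map var_occs ts)) x \<ge> 2 \<Longrightarrow> x \<in> fst ` snd (snd st2)"
    using 5(2)[OF refl 1[symmetric] 2] by blast+
  have dup: "x \<in> fst ` snd (snd st2)"
    if "x \<in> fst st \<and> x \<in> \<Union> (ct_vars ` set (t # ts)) \<or>
      count_list (concat (map var_occs (t # ts))) x \<ge> 2" for x
  proof -
    let ?m = "count_list (var_occs t) x" and ?n = "count_list (concat (map var_occs ts)) x"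
    have "x \<in> fst st \<and> x \<in> \<Union> (ct_vars ` set (t # ts)) \<or> ?m + ?n \<ge> 2"
      using that by simp
    \<comment> \<open>Two occurrences lie both in the first term, both in the rest, or one in each.
      In the last case the variable enters the rest as already met.\<close>
    then consider "x \<in> fst st \<and> x \<in> ct_vars t \<or> ?m \<ge> 2"
      | "x \<in> fst st \<and> x \<in> \<Union> (ct_vars ` set ts) \<or> ?n \<ge> 2" | "?m > 0" "?n > 0"
      by (cases "?m = 0"; cases "?n = 0") auto
    then show ?thesis
    proof cases
      case 1
      from dup1[OF this] J2 show ?thesis by blast
    next
      case 2
      with S1 show ?thesis using dup2[of x] by blast
    next
      case 3
      then have "x \<in> fst st1 \<and> x \<in> \<Union> (ct_vars ` set ts)"
        unfolding S1 count_list_pos by simp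
      then show ?thesis using dup2[of x] by blast
    qed
  qed
  have "fst st2 = fst st \<union> \<Union> (ct_vars ` set (t # ts))" using S1 S2 by auto
  with J1 J2 fin1 fin2 dup show ?case unfolding st' by blast
qed (auto split: prod.splits if_splits)

text \<open>When \<open>\<theta>\<close> gives each copy the value of its original, linearization
  changes the instance only at occurrences of \<open>CBot\<close>, which become fresh variables and
  can only grow.\<close>

lemma lin_approx:
  fixes t :: "('v, 'c) ct" and ts :: "('v, 'c) ct list"
  shows "lin_ct \<nu> t st = (t', st') \<Longrightarrow> (\<And>x y. (x, y) \<in> snd (snd st') \<Longrightarrow> \<theta> x = \<theta> y) \<Longrightarrow>
    subst_ct \<theta> t \<sqsubseteq> subst_ct \<theta> t'"
  and "lin_cts \<nu> ts st = (ts', st') \<Longrightarrow> (\<And>x y. (x, y) \<in> snd (snd st') \<Longrightarrow> \<theta> x = \<theta> y) \<Longrightarrow>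
    list_all2 (\<sqsubseteq>) (map (subst_ct \<theta>) ts) (map (subst_ct \<theta>) ts')"
proof (induction \<nu> t st and \<nu> ts st arbitrary: t' st' and ts' st' rule: lin_ct_lin_cts.induct)
  case (2 \<nu> x S k J)
  show ?case
  proof (cases "x \<in> S")
    case True
    with 2(1) have "t' = CVar (\<nu> k)" "(x, \<nu> k) \<in> snd (snd st')" by auto
    with 2(2)[of x "\<nu> k"] show ?thesis by (simp add: approx_refl)
  next
    case False
    with 2(1) show ?thesis by (simp add: approx_refl)
  qed
next
  case (5 \<nu> t ts st)
  obtain t1 st1 where 1: "lin_ct \<nu> t st = (t1, st1)" by (meson surj_pair)
  obtain ts2 st2 where 2: "lin_cts \<nu> ts st1 = (ts2, st2)" by (meson surj_pair)
  have st': "st' = st2" "ts' = t1 # ts2" using 5(3) 1 2 by simp_all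
  have "snd (snd st1) \<subseteq> snd (snd st2)" using lin_state(2)[OF 2] by blast
  then show ?case
    using 5(1)[OF 1] 5(2)[OF refl 1[symmetric] 2] 5(4) unfolding st' by auto
qed (auto simp: approx_bot approx_refl intro: approx_con split: prod.splits if_splits)

text \<open>Linearization is undone by fixing the original variables and sending each fresh variable
  to what it replaced, \<open>CBot\<close> or the repeated variable. The table \<open>g\<close>
  lists these values by index, for the indices consumed by the traversal. The claim ranges over
  every \<open>\<theta>\<close> agreeing with \<open>g\<close> there, so that the tables of
  consecutive traversals can be combined.\<close>

lemma lin_reverse:
  fixes t :: "('v, 'c) ct" and ts :: "('v, 'c) ct list"
  shows "lin_ct \<nu> t st = (t', st') \<Longrightarrow> ct_vars t \<subseteq> V \<Longrightarrow> fst st \<subseteq> V \<Longrightarrow>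
    fst (snd st) \<le> fst (snd st') \<and> (\<exists>g. (\<forall>i. wf_ct sg (g i)) \<and>
      (\<forall>\<theta>. (\<forall>x \<in> V. \<theta> x = CVar x) \<and> (\<forall>i. fst (snd st) \<le> i \<and> i < fst (snd st') \<longrightarrow> \<theta> (\<nu> i) = g i) \<longrightarrow>
        subst_ct \<theta> t' = t \<and>
        (\<forall>x y. (x, y) \<in> snd (snd st') - snd (snd st) \<longrightarrow> x \<in> V \<and> \<theta> y = CVar x)))"
  and "lin_cts \<nu> ts st = (ts', st') \<Longrightarrow> \<Union> (ct_vars ` set ts) \<subseteq> V \<Longrightarrow> fst st \<subseteq> V \<Longrightarrow>
    fst (snd st) \<le> fst (snd st') \<and> (\<exists>g. (\<forall>i. wf_ct sg (g i)) \<and>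
      (\<forall>\<theta>. (\<forall>x \<in> V. \<theta> x = CVar x) \<and> (\<forall>i. fst (snd st) \<le> i \<and> i < fst (snd st') \<longrightarrow> \<theta> (\<nu> i) = g i) \<longrightarrow>
        map (subst_ct \<theta>) ts' = ts \<and>
        (\<forall>x y. (x, y) \<in> snd (snd st') - snd (snd st) \<longrightarrow> x \<in> V \<and> \<theta> y = CVar x)))"
proof (induction \<nu> t st and \<nu> ts st arbitrary: t' st' and ts' st' rule: lin_ct_lin_cts.induct)
  case (1 \<nu> S k J)
  then have "t' = CVar (\<nu> k)" "st' = (S, Suc k, J)" by simp_all
  then show ?case by (intro conjI exI[of _ "\<lambda>_. CBot"]) auto
next
  case (2 \<nu> x S k J)
  have "x \<in> V" using 2(2) by simp
  show ?case
  proof (cases "x \<in> S")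
    case True
    with 2 have "t' = CVar (\<nu> k)" "st' = (S, Suc k, insert (x, \<nu> k) J)" by simp_all
    with \<open>x \<in> V\<close> show ?thesis by (intro conjI exI[of _ "\<lambda>_. CVar x"]) auto
  next
    case False
    with 2 have "t' = CVar x" "st' = (insert x S, k, J)" by simp_all
    with \<open>x \<in> V\<close> show ?thesis by (intro conjI exI[of _ "\<lambda>_. CBot"]) auto
  qed
next
  case (3 \<nu> c ts st)
  obtain ts1 st1 where 1: "lin_cts \<nu> ts st = (ts1, st1)" by (meson surj_pair)
  with 3(2) have "t' = CCon c ts1" "st' = st1" by simp_all
  with 3(1)[OF 1] 3(3,4) show ?case by simp
next
  case (4 \<nu> st)
  then have "ts' = []" "st' = st" by simp_all
  then show ?case by (intro conjI exI[of _ "\<lambda>_. CBot"]) auto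
next
  case (5 \<nu> t ts st)
  obtain t1 st1 where 1: "lin_ct \<nu> t st = (t1, st1)" by (meson surj_pair)
  obtain ts2 st2 where 2: "lin_cts \<nu> ts st1 = (ts2, st2)" by (meson surj_pair)
  have st': "st' = st2" "ts' = t1 # ts2" using 5(3) 1 2 by simp_all
  have V: "ct_vars t \<subseteq> V" "\<Union> (ct_vars ` set ts) \<subseteq> V" "fst st \<subseteq> V" using 5(4,5) by auto
  then have V1: "fst st1 \<subseteq> V" using lin_state(1)[OF 1] by auto
  let ?P = "\<lambda>st st' g \<theta>. (\<forall>x \<in> V. \<theta> x = CVar x) \<and>
    (\<forall>i. fst (snd st) \<le> i \<and> i < fst (snd st') \<longrightarrow> \<theta> (\<nu> i) = g i)"
  let ?J = "\<lambda>st st' \<theta>. \<forall>x y. (x, y) \<in> snd (snd st') - snd (snd st) \<longrightarrow> x \<in> V \<and> \<theta> y = CVar x"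
  obtain g1 where le1: "fst (snd st) \<le> fst (snd st1)" and wf1: "\<forall>i. wf_ct sg (g1 i)"
    and g1: "\<And>\<theta>. ?P st st1 g1 \<theta> \<Longrightarrow> subst_ct \<theta> t1 = t \<and> ?J st st1 \<theta>"
    using 5(1)[OF 1 V(1,3)] by blast
  obtain g2 where le2: "fst (snd st1) \<le> fst (snd st2)" and wf2: "\<forall>i. wf_ct sg (g2 i)"
    and g2: "\<And>\<theta>. ?P st1 st2 g2 \<theta> \<Longrightarrow> map (subst_ct \<theta>) ts2 = ts \<and> ?J st1 st2 \<theta>"
    using 5(2)[OF refl 1[symmetric] 2 V(2) V1] by blast
  \<comment> \<open>The first term and the rest consume adjacent ranges of indices, which meet at
    the index reached in \<open>st1\<close>; the tables are glued there.\<close>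
  define g where "g i = (if i < fst (snd st1) then g1 i else g2 i)" for i
  have "map (subst_ct \<theta>) ts' = t # ts \<and> ?J st st' \<theta>" if P: "?P st st' g \<theta>" for \<theta>
  proof -
    have "\<theta> (\<nu> i) = g1 i" if "fst (snd st) \<le> i" "i < fst (snd st1)" for i
      using P that le2 unfolding st' by (simp add: g_def)
    then have 1: "subst_ct \<theta> t1 = t \<and> ?J st st1 \<theta>" using P g1 by blast
    have "\<theta> (\<nu> i) = g2 i" if "fst (snd st1) \<le> i" "i < fst (snd st2)" for i
      using P that le1 unfolding st' by (simp add: g_def)
    then have 2: "map (subst_ct \<theta>) ts2 = ts \<and> ?J st1 st2 \<theta>" using P g2 by blast
    have "?J st st' \<theta>" using 1 2 unfolding st' by blast
    with 1 2 show ?thesis unfolding st' by simp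
  qed
  moreover have "\<forall>i. wf_ct sg (g i)" using wf1 wf2 by (simp add: g_def)
  moreover have "fst (snd st) \<le> fst (snd st')" using le1 le2 unfolding st' by simp
  ultimately show ?case by blast
qed

section \<open>Rules of a closure and their instances\<close>

lemma crr_cases:
  fixes ts :: "('v, 'c) ct list"
  assumes inf: "infinite (UNIV :: 'v set)"
    and V: "V = \<Union> (ct_vars ` set ts) \<union> ct_vars r"
  obtains \<nu> ts' S k J where "inj \<nu>" and "range \<nu> \<inter> V = {}"
    and "lin_cts \<nu> ts ({}, 0, {}) = (ts', S, k, J)"
    and "crr f ts r = Rule f ts' (emb r) ({(Var x, Var y) | x y. (x, y) \<in> J} \<union>
      {(Var x, Var x) | x. x \<in> ct_vars r \<or> count_list (concat (map var_occs ts)) x = 1})"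
proof -
  have fresh: "inj (fresh V)" "range (fresh V) \<inter> V = {}"
    using fresh_spec[OF inf, of V] unfolding V by auto
  obtain ts' S k J where lin: "lin_cts (fresh V) ts ({}, 0, {}) = (ts', S, k, J)"
    by (metis surj_pair)
  show thesis
    by (rule that[OF fresh lin]) (simp add: crr_def Let_def lin flip: V)
qed

lemma head_crr [simp]: "head (crr f ts r) = f"
  by (simp add: crr_def Let_def split: prod.split)

lemma closureE:
  assumes "\<rho> \<in> closure sg R"
  obtains ts r where "\<rho> = crr (head \<rho>) ts r" and "head \<rho> \<in> exports R"
    and "ts \<in> tuples sg (head \<rho>)" and "r \<in> CTerm_bot sg"
    and "crwl sg R (Fun (head \<rho>) (map emb ts) \<rightarrow>\<^sub>r emb r)"
  using assms unfolding closure_def by auto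

text \<open>A total term below both \<open>s\<close> and \<open>t\<close> equals both by maximality.
  A joinability condition between variables thus says that their images coincide and are
  total.\<close>

lemma models_id_Vars_iff:
  assumes "\<theta> \<in> CSubst_bot sg"
  shows "models_id sg A (map_prod (subst_trm \<theta>) (subst_trm \<theta>) ` {(Var x, Var y) | x y. P x y}) \<longleftrightarrow>
    (\<forall>x y. P x y \<longrightarrow> \<theta> x = \<theta> y \<and> total_ct (\<theta> x))"
proof -
  have "down s \<inter> down t \<inter> CTerm sg \<noteq> {} \<longleftrightarrow> s = t \<and> total_ct s" if "wf_ct sg s"
    for s t :: "('a, 'b) ct"
  proof
    assume "down s \<inter> down t \<inter> CTerm sg \<noteq> {}"
    then obtain u where u: "u \<sqsubseteq> s" "u \<sqsubseteq> t" "total_ct u" by (auto simp: down_def CTerm_def)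
    with total_ct_approx[OF u(3)] show "s = t \<and> total_ct s" by blast
  next
    assume "s = t \<and> total_ct s"
    then have "s \<in> down s \<inter> down t \<inter> CTerm sg" using that by (auto simp: down_def CTerm_def approx_refl)
    then show "down s \<inter> down t \<inter> CTerm sg \<noteq> {}" by blast
  qed
  moreover have "wf_ct sg (\<theta> x)" for x using assms by (simp add: CSubst_bot_def CTerm_bot_def)
  ultimately show ?thesis
    unfolding models_id_def by (fastforce simp: eval_emb)
qed

lemma admissible_closure:
  fixes R :: "('v, 'c, 'f) rule set"
  assumes inf: "infinite (UNIV :: 'v set)" and R: "admissible sg R"
  shows "admissible sg (closure sg R)"
  unfolding admissible_def
proof (intro allI impI)
  fix f ss r' C assume "Rule f ss r' C \<in> closure sg R"
  then obtain ts r where f: "f \<in> exports R" and ts: "ts \<in> tuples sg f" and r: "r \<in> CTerm_bot sg"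
    and rule: "Rule f ss r' C = crr f ts r"
    by (rule closureE) simp
  obtain \<nu> ts' S k J where lin: "lin_cts \<nu> ts ({}, 0, {}) = (ts', S, k, J)"
    and crr: "crr f ts r = Rule f ts' (emb r) ({(Var x, Var y) | x y. (x, y) \<in> J} \<union>
      {(Var x, Var x) | x. x \<in> ct_vars r \<or> count_list (concat (map var_occs ts)) x = 1})"
    by (rule crr_cases[OF inf refl])
  have "f \<in> FS sg"
  proof -
    obtain \<rho> where "\<rho> \<in> R" "f = head \<rho>" using f by (auto simp: exports_def)
    then show ?thesis using admissibleD(1)[OF R] by (cases \<rho>) auto
  qed
  moreover have "length ts' = arF sg f \<and> (\<forall>t \<in> set ts'. wf_ct sg t)"
    using lin_wf(2)[OF lin, of sg] ts by (auto simp: tuples_def CTerm_bot_def)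
  moreover have "finite {(Var x :: ('v, 'c, 'f) trm, Var y :: ('v, 'c, 'f) trm) | x y. (x, y) \<in> J}"
  proof -
    have "finite J" using lin_state(2)[OF lin] by simp
    then have "finite (map_prod Var Var ` J :: (('v, 'c, 'f) trm \<times> ('v, 'c, 'f) trm) set)" by simp
    then show ?thesis by (rule rev_finite_subset) force
  qed
  moreover have "finite {(Var x :: ('v, 'c, 'f) trm, Var x :: ('v, 'c, 'f) trm) | x.
      x \<in> ct_vars r \<or> count_list (concat (map var_occs ts)) x = 1}"
  proof -
    have "x \<in> \<Union> (ct_vars ` set ts)" if "count_list (concat (map var_occs ts)) x = 1" for x
      using that count_list_pos[of "concat (map var_occs ts)" x] by simp
    then have "{x. x \<in> ct_vars r \<or> count_list (concat (map var_occs ts)) x = 1} \<subseteq>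
      ct_vars r \<union> \<Union> (ct_vars ` set ts)" by blast
    from finite_subset[OF this] show ?thesis by (simp add: setcompr_eq_image)
  qed
  ultimately show "f \<in> FS sg \<and> length ss = arF sg f \<and> (\<forall>t \<in> set ss. wf_ct sg t) \<and>
     wf_trm sg r' \<and> finite C \<and> (\<forall>(a, b) \<in> C. wf_trm sg a \<and> wf_trm sg b)"
    using rule r unfolding crr by (auto simp: CTerm_bot_def)
qed

lemma exports_closure: "exports (closure sg R) \<subseteq> exports R"
  by (auto simp: exports_def elim: closureE)

text \<open>The conditions of \<open>crr f ts r\<close> force an instance to be total on the variables of \<open>ts\<close> and
  \<open>r\<close> and to identify the copies of a repeated variable. Such an instance is therefore justified
  by a total instance of the derivation of \<open>r\<close>, so that the operator is constant.\<close>

lemma T_op_closure: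
  fixes R :: "('v, 'c, 'f) rule set"
  assumes inf: "infinite (UNIV :: 'v set)" and R: "admissible sg R"
    and f: "f \<in> FS sg" and us: "us \<in> tuples sg f"
  shows "T_op sg (closure sg R) A f us = T_omega sg R bot_alg f us"
proof
  let ?W = "T_omega sg R bot_alg"
  show "T_op sg (closure sg R) A f us \<subseteq> ?W f us"
  proof
    fix t assume "t \<in> T_op sg (closure sg R) A f us"
    then consider "t = CBot"
      | ss r' C where "Rule f ss r' C \<in> instances sg (closure sg R)" "list_all2 (\<sqsubseteq>) ss us"
          "models_id sg A C" "t \<in> eval A CVar r'"
      unfolding T_op_iff by blast
    then show "t \<in> ?W f us"
    proof cases
      case 2
      obtain \<theta> ss0 r0 C0 where \<theta>: "\<theta> \<in> CSubst_bot sg" and rule: "Rule f ss0 r0 C0 \<in> closure sg R"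
        and inst: "ss = map (subst_ct \<theta>) ss0" "r' = subst_trm \<theta> r0"
        "C = map_prod (subst_trm \<theta>) (subst_trm \<theta>) ` C0"
        using 2(1) by (rule instancesE)
      obtain ts r where ts: "ts \<in> tuples sg f" and r: "r \<in> CTerm_bot sg"
        and crwl: "crwl sg R (Fun f (map emb ts) \<rightarrow>\<^sub>r emb r)"
        and rule': "Rule f ss0 r0 C0 = crr f ts r"
        using rule by (rule closureE) simp
      obtain \<nu> ts' S k J where lin: "lin_cts \<nu> ts ({}, 0, {}) = (ts', S, k, J)"
        and crr: "crr f ts r = Rule f ts' (emb r) ({(Var x, Var y) | x y. (x, y) \<in> J} \<union>
          {(Var x, Var x) | x. x \<in> ct_vars r \<or> count_list (concat (map var_occs ts)) x = 1})"
        by (rule crr_cases[OF inf refl])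
      let ?P = "\<lambda>x y. (x, y) \<in> J \<or>
        x = y \<and> (x \<in> ct_vars r \<or> count_list (concat (map var_occs ts)) x = 1)"
      have eqs: "ss0 = ts'" "r0 = emb r" "C0 = {(Var x, Var y) | x y. ?P x y}"
        using rule' unfolding crr by auto
      have C: "\<theta> x = \<theta> y \<and> total_ct (\<theta> x)" if "?P x y" for x y
        using 2(3) models_id_Vars_iff[OF \<theta>, of A ?P] that unfolding inst eqs by blast
      \<comment> \<open>\<open>\<theta>\<close> may be partial, for instance on the fresh variables
        that replaced \<open>CBot\<close>, and consistency requires a total substitution.
        \<open>\<sigma>\<close> keeps \<open>\<theta>\<close> on the original variables of
        \<open>ts\<close> and \<open>r\<close>, where the conditions force totality, and is the
        identity elsewhere.\<close>
      define \<sigma> where "\<sigma> x = (if x \<in> \<Union> (ct_vars ` set ts) \<union> ct_vars r then \<theta> x else CVar x)" for x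
      have "total_ct (\<theta> x)" if x: "x \<in> \<Union> (ct_vars ` set ts)" for x
      proof -
        \<comment> \<open>A variable occurring once has its own condition with itself in
          \<open>crr\<close>; a repeated one is the first component of a pair in
          \<open>J\<close>.\<close>
        have "count_list (concat (map var_occs ts)) x > 0" using x by (simp add: count_list_pos)
        then consider "count_list (concat (map var_occs ts)) x = 1"
          | "count_list (concat (map var_occs ts)) x \<ge> 2" by linarith
        then show ?thesis
        proof cases
          case 1
          with C[of x x] show ?thesis by simp
        next
          case 2
          then have "x \<in> fst ` J" using lin_state(2)[OF lin] by auto
          with C show ?thesis by fastforce
        qed
      qed
      moreover have "total_ct (\<theta> x)" if "x \<in> ct_vars r" for x using C[of x x] that by simp
      ultimately have \<sigma>: "\<sigma> \<in> CSubst sg"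
        using \<theta> by (auto simp: \<sigma>_def CSubst_def CTerm_def CSubst_bot_def CTerm_bot_def)
      have "map (subst_ct \<sigma>) ts = map (subst_ct \<theta>) ts"
        by (intro map_cong refl subst_ct_cong) (auto simp: \<sigma>_def)
      moreover have "list_all2 (\<sqsubseteq>) (map (subst_ct \<theta>) ts) (map (subst_ct \<theta>) ts')"
        using lin_approx(2)[OF lin, of \<theta>] C by simp
      ultimately have below: "list_all2 (\<sqsubseteq>) (map (subst_ct \<sigma>) ts) us"
        using approx_list_trans 2(2) unfolding inst eqs by metis
      have \<sigma>r: "subst_ct \<sigma> r = subst_ct \<theta> r"
        by (rule subst_ct_cong) (simp add: \<sigma>_def)
      have "r \<in> ?W f ts" using crwl crwl_Fun_iff[OF R f ts] by blast
      then have "subst_ct \<sigma> r \<in> ?W f (map (subst_ct \<sigma>) ts)"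
        using T_omega_consistent[OF R] f ts \<sigma> unfolding consistent_def by blast
      moreover have "map (subst_ct \<sigma>) ts \<in> tuples sg f"
        using ts wf_subst_ct[OF CSubst_imp_bot[OF \<sigma>]] by (auto simp: tuples_def CTerm_bot_def)
      ultimately have W: "subst_ct \<theta> r \<in> ?W f us"
        using T_omega_term_alg[OF R] f us below unfolding term_alg_def \<sigma>r by blast
      have "t \<sqsubseteq> subst_ct \<theta> r"
        using 2(4) unfolding inst eqs subst_trm_emb eval_emb down_def by simp
      with W T_omega_term_alg[OF R] f us show ?thesis
        unfolding term_alg_def cone_def by blast
    qed simp
  qed
  show "?W f us \<subseteq> T_op sg (closure sg R) A f us"
  proof
    fix r assume r: "r \<in> ?W f us"
    show "r \<in> T_op sg (closure sg R) A f us"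
    proof (cases "r = CBot")
      case False
      let ?V = "\<Union> (ct_vars ` set us) \<union> ct_vars r"
      have wf: "wf_ct sg r"
        using T_omega_term_alg[OF R] f us r by (auto simp: term_alg_def cone_def CTerm_bot_def)
      have "f \<in> exports R" using r False T_omega_not_head by fastforce
      moreover have "crwl sg R (Fun f (map emb us) \<rightarrow>\<^sub>r emb r)"
        using r crwl_Fun_iff[OF R f us] by blast
      ultimately have rule: "crr f us r \<in> closure sg R"
        using us wf False unfolding closure_def by (auto simp: CTerm_bot_def)
      obtain \<nu> ts' S k J where \<nu>: "inj \<nu>" "range \<nu> \<inter> ?V = {}"
        and lin: "lin_cts \<nu> us ({}, 0, {}) = (ts', S, k, J)"
        and crr: "crr f us r = Rule f ts' (emb r) ({(Var x, Var y) | x y. (x, y) \<in> J} \<union>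
          {(Var x, Var x) | x. x \<in> ct_vars r \<or> count_list (concat (map var_occs us)) x = 1})"
        by (rule crr_cases[OF inf refl])
      \<comment> \<open>The protected set includes the variables of \<open>r\<close>, since the
        right-hand side must also come back unchanged.\<close>
      from lin_reverse(2)[OF lin Un_upper1, of "ct_vars r" sg, unfolded fst_conv snd_conv,
          OF empty_subsetI]
      obtain g where g_wf: "\<forall>i. wf_ct sg (g i)"
        and g: "\<forall>\<theta>. (\<forall>x \<in> ?V. \<theta> x = CVar x) \<and> (\<forall>i. 0 \<le> i \<and> i < k \<longrightarrow> \<theta> (\<nu> i) = g i) \<longrightarrow>
          map (subst_ct \<theta>) ts' = us \<and> (\<forall>x y. (x, y) \<in> J - {} \<longrightarrow> x \<in> ?V \<and> \<theta> y = CVar x)"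
        by (elim conjE exE)
      \<comment> \<open>The inverse of the linearization: values from the table \<open>g\<close> on
        the fresh variables, identity elsewhere. It is well defined because the fresh variables are
        distinct and avoid \<open>?V\<close>, and it makes \<open>us\<close> itself the argument
        tuple of the instance.\<close>
      define \<theta> where "\<theta> x = (if x \<in> ?V then CVar x else if x \<in> range \<nu> then g (inv \<nu> x) else CVar x)"
        for x
      have \<theta>V: "\<forall>x \<in> ?V. \<theta> x = CVar x" by (simp add: \<theta>_def)
      moreover have "\<forall>i<k. \<theta> (\<nu> i) = g i"
      proof (intro allI impI)
        fix i
        have "\<nu> i \<notin> ?V" using \<nu>(2) by blast
        then show "\<theta> (\<nu> i) = g i" using \<nu>(1) unfolding \<theta>_def by simp
      qed
      ultimately have "map (subst_ct \<theta>) ts' = us \<and>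
          (\<forall>x y. (x, y) \<in> J - {} \<longrightarrow> x \<in> ?V \<and> \<theta> y = CVar x)"
        by (intro g[rule_format]) blast
      then have g': "map (subst_ct \<theta>) ts' = us"
        "\<And>x y. (x, y) \<in> J \<Longrightarrow> x \<in> ?V \<and> \<theta> y = CVar x"
        by blast+
      have \<theta>: "\<theta> \<in> CSubst_bot sg"
        using g_wf by (auto simp: CSubst_bot_def CTerm_bot_def \<theta>_def)
      let ?P = "\<lambda>x y. (x, y) \<in> J \<or>
        x = y \<and> (x \<in> ct_vars r \<or> count_list (concat (map var_occs us)) x = 1)"
      have C_eq: "{(Var x, Var y) | x y. (x, y) \<in> J} \<union>
          {(Var x, Var x) | x. x \<in> ct_vars r \<or> count_list (concat (map var_occs us)) x = 1} =
          {(Var x, Var y) | x y. ?P x y}" by blast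
      have "\<theta> x = \<theta> y \<and> total_ct (\<theta> x)" if "?P x y" for x y
        using that
      proof
        assume "(x, y) \<in> J"
        with g'(2)[OF this] \<theta>V show ?thesis by simp
      next
        assume xy: "x = y \<and> (x \<in> ct_vars r \<or> count_list (concat (map var_occs us)) x = 1)"
        have "x \<in> \<Union> (ct_vars ` set us)" if "count_list (concat (map var_occs us)) x = 1"
          using that count_list_pos[of "concat (map var_occs us)" x] by simp
        with xy have "x \<in> ?V" by blast
        with \<theta>V xy show ?thesis by simp
      qed
      then have mod: "models_id sg A (map_prod (subst_trm \<theta>) (subst_trm \<theta>) ` {(Var x, Var y) | x y. ?P x y})"
        unfolding models_id_Vars_iff[OF \<theta>] by blast
      have ev: "r \<in> eval A CVar (subst_trm \<theta> (emb r))"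
        using \<theta>V by (simp add: subst_trm_emb subst_ct_id eval_emb down_def approx_refl)
      show ?thesis
        unfolding T_op_iff
        by (intro disjI2 exI conjI,
            rule instancesI[OF \<theta> rule[unfolded crr C_eq], unfolded g'(1)],
            rule approx_list_refl, rule mod, rule ev)
    qed simp
  qed
qed

section \<open>The operator and the module operations\<close>

lemma wf_ct_cong: "DS sg' = DS sg \<Longrightarrow> arD sg' = arD sg \<Longrightarrow> wf_ct sg' t \<longleftrightarrow> wf_ct sg t"
  by (induction t) auto

definition sig_map :: "('c, 'f) sig \<Rightarrow> ('c, 'g) sig \<Rightarrow> ('f \<Rightarrow> 'g) \<Rightarrow> bool" where
  "sig_map sg sg' h \<longleftrightarrow> DS sg' = DS sg \<and> arD sg' = arD sg \<and>
     (\<forall>f \<in> FS sg. h f \<in> FS sg' \<and> arF sg' (h f) = arF sg f)"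

lemma wf_map_trm: "sig_map sg sg' h \<Longrightarrow> wf_trm sg e \<Longrightarrow> wf_trm sg' (map_trm id id h e)"
  by (induction e) (auto simp: sig_map_def)

lemma admissible_map:
  assumes "sig_map sg sg' h" and R: "admissible sg R"
  shows "admissible sg' (map_rule_funs h ` R)"
  unfolding admissible_def
proof (intro allI impI)
  fix g ts r C assume "Rule g ts r C \<in> map_rule_funs h ` R"
  then obtain \<rho> where \<rho>: "\<rho> \<in> R" "Rule g ts r C = map_rule_funs h \<rho>" by blast
  obtain f ts' r' C' where [simp]: "\<rho> = Rule f ts' r' C'" by (cases \<rho>)
  note wf = admissibleD[OF R \<rho>(1)[simplified]]
  show "g \<in> FS sg' \<and> length ts = arF sg' g \<and> (\<forall>t \<in> set ts. wf_ct sg' t) \<and> wf_trm sg' r \<and>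
     finite C \<and> (\<forall>(a, b) \<in> C. wf_trm sg' a \<and> wf_trm sg' b)"
    using wf \<rho>(2) wf_map_trm[OF assms(1)] assms(1)
    by (auto simp: sig_map_def wf_ct_cong[of sg' sg])
qed

lemma map_trm_emb: "map_trm id id h (emb t) = emb t"
  by (induction t) auto

lemma map_trm_subst: "map_trm id id h (subst_trm \<theta> e) = subst_trm \<theta> (map_trm id id h e)"
  by (induction e) (auto simp: map_trm_emb map_trm_emb[unfolded id_def])

lemma subst_map_rule_funs: "subst_rule \<theta> (map_rule_funs h \<rho>) = map_rule_funs h (subst_rule \<theta> \<rho>)"
  by (cases \<rho>) (auto simp: map_trm_subst image_image map_prod_def case_prod_beta)

lemma head_map_rule_funs [simp]: "head (map_rule_funs h \<rho>) = h (head \<rho>)"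
  by (cases \<rho>) auto

lemma head_subst_rule [simp]: "head (subst_rule \<theta> \<rho>) = head \<rho>"
  by (cases \<rho>) auto

lemma rule_funs_map: "rule_funs (map_rule_funs h \<rho>) = h ` rule_funs \<rho>"
  by (cases \<rho>) (simp add: rule_funs_def trm.set_map image_Un image_UN case_prod_beta)

text \<open>Substitutions do not see function symbols, so renaming commutes with forming instances,
  and evaluating a renamed term amounts to evaluating the original in the algebra pulled back along
  \<open>h\<close>. The existential over \<open>f\<close> accounts for symbols that \<open>h\<close>
  identifies, whose rules are merged.\<close>

lemma T_op_map:
  fixes sg :: "('c, 'f) sig" and sg' :: "('c, 'g) sig" and R :: "('v, 'c, 'f) rule set"
  assumes sg: "DS sg' = DS sg" "arD sg' = arD sg"
  shows "t \<in> T_op sg' (map_rule_funs h ` R) A g ts \<longleftrightarrow>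
    t = CBot \<or> (\<exists>f. h f = g \<and> t \<in> T_op sg R (\<lambda>f. A (h f)) f ts)"
proof -
  have ct: "CSubst_bot sg' = (CSubst_bot sg :: ('v \<Rightarrow> ('v, 'c) ct) set)"
    "CTerm sg' = (CTerm sg :: ('v, 'c) ct set)"
    using wf_ct_cong[OF sg] by (auto simp: CSubst_bot_def CTerm_bot_def CTerm_def)
  have inst: "instances sg' (map_rule_funs h ` R) = map_rule_funs h ` instances sg R"
  proof -
    have "instances sg R = (\<Union>\<theta> \<in> CSubst_bot sg. subst_rule \<theta> ` R)"
      "instances sg' (map_rule_funs h ` R) =
        (\<Union>\<theta> \<in> CSubst_bot sg'. subst_rule \<theta> ` map_rule_funs h ` R)"
      by (auto simp: instances_def)
    then show ?thesis by (simp add: ct image_UN image_image subst_map_rule_funs)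
  qed
  have rule: "Rule g ss r C \<in> map_rule_funs h ` instances sg R \<longleftrightarrow>
    (\<exists>f r' C'. Rule f ss r' C' \<in> instances sg R \<and> h f = g \<and> r = map_trm id id h r' \<and>
      C = map_prod (map_trm id id h) (map_trm id id h) ` C')" for ss r C
  proof
    assume "Rule g ss r C \<in> map_rule_funs h ` instances sg R"
    then obtain \<rho> where "\<rho> \<in> instances sg R" "Rule g ss r C = map_rule_funs h \<rho>" by blast
    then show "\<exists>f r' C'. Rule f ss r' C' \<in> instances sg R \<and> h f = g \<and> r = map_trm id id h r' \<and>
      C = map_prod (map_trm id id h) (map_trm id id h) ` C'"
      by (cases \<rho>) auto
  next
    assume "\<exists>f r' C'. Rule f ss r' C' \<in> instances sg R \<and> h f = g \<and> r = map_trm id id h r' \<and>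
      C = map_prod (map_trm id id h) (map_trm id id h) ` C'"
    then show "Rule g ss r C \<in> map_rule_funs h ` instances sg R" by (force simp: image_iff)
  qed
  have models: "models_id sg' A (map_prod (map_trm id id h) (map_trm id id h) ` C) \<longleftrightarrow>
    models_id sg (\<lambda>f. A (h f)) C" for C
    by (simp add: models_id_def ct eval_map_trm case_prod_beta)
  show ?thesis
  proof
    assume "t \<in> T_op sg' (map_rule_funs h ` R) A g ts"
    then consider "t = CBot" | f ss r C where "Rule f ss r C \<in> instances sg R" "h f = g"
        "list_all2 (\<sqsubseteq>) ss ts" "models_id sg (\<lambda>f. A (h f)) C" "t \<in> eval (\<lambda>f. A (h f)) CVar r"
      unfolding T_op_iff inst rule using models eval_map_trm[of A CVar h] by blast
    then show "t = CBot \<or> (\<exists>f. h f = g \<and> t \<in> T_op sg R (\<lambda>f. A (h f)) f ts)"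
      unfolding T_op_iff by cases blast+
  next
    assume "t = CBot \<or> (\<exists>f. h f = g \<and> t \<in> T_op sg R (\<lambda>f. A (h f)) f ts)"
    then consider "t = CBot" | f ss r C where "Rule f ss r C \<in> instances sg R" "h f = g"
        "list_all2 (\<sqsubseteq>) ss ts" "models_id sg (\<lambda>f. A (h f)) C" "t \<in> eval (\<lambda>f. A (h f)) CVar r"
      unfolding T_op_iff by blast
    then show "t \<in> T_op sg' (map_rule_funs h ` R) A g ts"
    proof cases
      case 2
      then have "Rule g ss (map_trm id id h r) (map_prod (map_trm id id h) (map_trm id id h) ` C) \<in>
          map_rule_funs h ` instances sg R"
        unfolding rule by blast
      with 2 show ?thesis
        unfolding T_op_iff inst models[symmetric] eval_map_trm[symmetric] by blast
    qed simp
  qed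
qed

lemma T_op_Un: "T_op sg (R \<union> S) A f ts = T_op sg R A f ts \<union> T_op sg S A f ts"
proof -
  have "instances sg (R \<union> S) = instances sg R \<union> instances sg S"
    by (auto simp: instances_def)
  then show ?thesis by (auto simp: T_op_def)
qed

lemma T_op_cong_heads:
  assumes "\<And>\<rho>. head \<rho> = f \<Longrightarrow> \<rho> \<in> R \<longleftrightarrow> \<rho> \<in> S"
  shows "T_op sg R A f ts = T_op sg S A f ts"
proof -
  have "Rule f ss r C \<in> instances sg R \<longleftrightarrow> Rule f ss r C \<in> instances sg S" for ss r C
    unfolding instances_def mem_Collect_eq using assms by (metis head_subst_rule rule.sel(1))
  then show ?thesis by (simp add: T_op_def)
qed

lemma T_op_delete:
  "T_op sg (delete \<sigma> R) A f ts = (if f \<in> \<sigma> then {CBot} else T_op sg R A f ts)"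
proof (cases "f \<in> \<sigma>")
  case True
  then have "f \<notin> exports (delete \<sigma> R)" by (auto simp: exports_def delete_def)
  with True show ?thesis by (simp add: T_op_not_head)
next
  case False
  then show ?thesis by (auto intro!: T_op_cong_heads simp: delete_def)
qed

section \<open>Open rules and hidden rules of a representation\<close>

lemma ext_sig_simps [simp]:
  "DS (ext_sig sg md) = DS sg" "arD (ext_sig sg md) = arD sg"
  "arF (ext_sig sg md) (Vis f) = arF sg f" "arF (ext_sig sg md) (Lab E f) = arF sg f"
  "Vis f \<in> FS (ext_sig sg md) \<longleftrightarrow> f \<in> FS sg"
  "Lab E f \<in> FS (ext_sig sg md) \<longleftrightarrow> modular_expr sg md E \<and> f \<in> FS sg"
  by (auto simp: ext_sig_def)

lemma wf_ct_ext_sig [simp]: "wf_ct (ext_sig sg md) t \<longleftrightarrow> wf_ct sg t"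
  by (rule wf_ct_cong) simp_all

lemma CTerm_bot_ext_sig [simp]: "CTerm_bot (ext_sig sg md) = CTerm_bot sg"
  by (simp add: CTerm_bot_def)

lemma tuples_ext_sig [simp]:
  "tuples (ext_sig sg md) (Vis f) = tuples sg f" "tuples (ext_sig sg md) (Lab E f) = tuples sg f"
  by (simp_all add: tuples_def)

text \<open>Union, deletion, renaming and the relabeling in a closure treat visible and bridge rules
  alike, and \<open>U_op\<close> applies both together, so a single set is tracked.\<close>

definition open_rules :: "('v, 'c, 'n, 'f) smodule \<Rightarrow> ('v, 'c, ('n, 'f) xsym) rule set" where
  "open_rules M = visible M \<union> bridge M"

lemma open_rules_simps [simp]:
  "open_rules (of_plain R) = map_rule_funs Vis ` R"
  "open_rules (sunion M N) = open_rules M \<union> open_rules N"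
  "open_rules (sdelete \<sigma> M) = delete (Vis ` \<sigma>) (open_rules M)"
  "open_rules (srename \<rho> M) = map_rule_funs (rename_vis \<rho>) ` open_rules M"
  "open_rules (sclosure sg E M) = bridge_rule sg E ` {f. Vis f \<in> exports (open_rules M)}"
  by (auto simp: open_rules_def of_plain_def sunion_def sdelete_def srename_def sclosure_def
      sexports_def delete_def)

text \<open>The subexpressions standing directly under a closure: by \<open>hidden_iota\<close>,
  these are the labels that contribute hidden rules.\<close>

primrec closed_subs :: "('n, 'f) mexp \<Rightarrow> ('n, 'f) mexp set" where
  "closed_subs (Name n) = {}"
| "closed_subs (Union E F) = closed_subs E \<union> closed_subs F"
| "closed_subs (Delete E \<sigma>) = closed_subs E"
| "closed_subs (Rename \<rho> E) = closed_subs E"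
| "closed_subs (Closure E) = insert E (closed_subs E)"

lemma closed_subs_trans: "P \<in> closed_subs E \<Longrightarrow> closed_subs P \<subseteq> closed_subs E"
  by (induction E) auto

lemma closed_subs_size: "P \<in> closed_subs E \<Longrightarrow> size P < size E"
  by (induction E) auto

lemma closed_subs_modular: "P \<in> closed_subs E \<Longrightarrow> modular_expr sg md E \<Longrightarrow> modular_expr sg md P"
  by (induction E) auto

lemma hidden_iota:
  "hidden (iota sg md E) =
    (\<Union>P \<in> closed_subs E. map_rule_funs (tau P) ` open_rules (iota sg md P))"
  by (induction E)
    (simp_all add: of_plain_def sunion_def sdelete_def srename_def sclosure_def open_rules_def)

lemma admissible_Un: "admissible sg R \<Longrightarrow> admissible sg S \<Longrightarrow> admissible sg (R \<union> S)"
  unfolding admissible_def by blast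

lemma admissible_delete: "admissible sg R \<Longrightarrow> admissible sg (delete \<sigma> R)"
  unfolding admissible_def delete_def by blast

lemma admissible_denote:
  fixes md :: "'n \<Rightarrow> ('v, 'c, 'f) rule set"
  assumes "infinite (UNIV :: 'v set)" and "modular_expr sg md E"
  shows "admissible sg (denote sg md E)"
  using assms(2)
proof (induction E)
  case (Rename \<rho> E)
  then have "sig_map sg sg \<rho>" by (auto simp: sig_map_def)
  with Rename show ?case by (simp add: admissible_map)
qed (auto simp: plain_module_def
    intro: admissible_program admissible_Un admissible_delete admissible_closure[OF assms(1)])

lemma admissible_exports: "admissible sg R \<Longrightarrow> exports R \<subseteq> FS sg"
proof
  fix f assume "admissible sg R" "f \<in> exports R"
  moreover from this obtain \<rho> where "\<rho> \<in> R" "f = head \<rho>" by (auto simp: exports_def)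
  ultimately show "f \<in> FS sg" by (cases \<rho>) (auto dest: admissibleD(1))
qed

lemma admissible_open_rules:
  fixes md :: "'n \<Rightarrow> ('v, 'c, 'f) rule set"
  assumes "modular_expr sg md E"
  shows "admissible (ext_sig sg md) (open_rules (iota sg md E))"
  using assms
proof (induction E)
  case (Name n)
  have "sig_map sg (ext_sig sg md) Vis" by (simp add: sig_map_def)
  with Name show ?case by (simp add: admissible_map admissible_program plain_module_def)
next
  case (Rename \<rho> E)
  have "rename_vis \<rho> x \<in> FS (ext_sig sg md) \<and>
      arF (ext_sig sg md) (rename_vis \<rho> x) = arF (ext_sig sg md) x" if "x \<in> FS (ext_sig sg md)" for x
    using that Rename.prems by (cases x) auto
  then have "sig_map (ext_sig sg md) (ext_sig sg md) (rename_vis \<rho>)" by (simp add: sig_map_def)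
  with Rename show ?case by (simp add: admissible_map)
next
  case (Closure E)
  then have "Vis f \<in> exports (open_rules (iota sg md E)) \<Longrightarrow> f \<in> FS sg" for f
    using admissible_exports by fastforce
  with Closure show ?case
    by (auto simp: admissible_def bridge_rule_def Let_def)
qed (auto intro: admissible_Un admissible_delete)

text \<open>Two facts about labels rest on this. Heads of open rules are visible, so after
  relabeling the head reveals the label a hidden rule belongs to. Labels inside open rules belong to
  closures strictly inside \<open>E\<close>, which makes induction on the size of labels
  possible.\<close>

lemma open_rules_funs:
  "\<rho> \<in> open_rules (iota sg md E) \<Longrightarrow>
    head \<rho> \<in> range Vis \<and> rule_funs \<rho> \<subseteq> range Vis \<union> {Lab P f | P f. P \<in> closed_subs E}"
proof (induction E arbitrary: \<rho>)
  case (Name n)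
  then show ?case by (auto simp: rule_funs_map)
next
  case (Union E F)
  then show ?case by auto blast+
next
  case (Delete E \<sigma>)
  then show ?case by (auto simp: delete_def)
next
  case (Rename h E)
  then obtain \<rho>' where \<rho>': "\<rho>' \<in> open_rules (iota sg md E)" "\<rho> = map_rule_funs (rename_vis h) \<rho>'"
    by auto
  have "rename_vis h x \<in> range Vis \<union> {Lab P f | P f. P \<in> closed_subs E}"
    if "x \<in> range Vis \<union> {Lab P f | P f. P \<in> closed_subs E}" for x
    using that by auto
  with Rename.IH[OF \<rho>'(1)] show ?case unfolding \<rho>'(2) by (auto simp: rule_funs_map)
next
  case (Closure E)
  then show ?case by (auto simp: bridge_rule_def Let_def rule_funs_def)
qed

lemma exports_map: "exports (map_rule_funs h ` R) = h ` exports R"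
  by (simp add: exports_def image_image)

lemma exports_bridge: "exports (bridge_rule sg E ` X) = Vis ` X"
  by (simp add: exports_def bridge_rule_def Let_def image_image)

text \<open>Only an inclusion: the semantic closure has no rule for a symbol from which nothing but
  \<open>CBot\<close> is derivable, while the structured closure still has a bridge for it. Such a
  bridge contributes just \<open>CBot\<close>.\<close>

lemma exports_denote:
  "f \<in> exports (denote sg md E) \<Longrightarrow> Vis f \<in> exports (open_rules (iota sg md E))"
proof (induction E arbitrary: f)
  case (Name n)
  then show ?case by (force simp: exports_def)
next
  case (Union E F)
  then show ?case by (auto simp: exports_def image_Un)
next
  case (Delete E \<sigma>)
  then have "f \<notin> \<sigma>" "f \<in> exports (denote sg md E)" by (auto simp: exports_def delete_def)
  with Delete.IH show ?case by (fastforce simp: exports_def delete_def)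
next
  case (Rename \<rho> E)
  then obtain g where g: "g \<in> exports (denote sg md E)" "f = \<rho> g" by (auto simp: exports_map)
  from imageI[OF Rename.IH[OF g(1)], of "rename_vis \<rho>"] g(2) show ?case
    by (simp add: exports_map)
next
  case (Closure E)
  then have "Vis f \<in> exports (open_rules (iota sg md E))" using exports_closure by fastforce
  then show ?case by (simp add: exports_bridge)
qed

text \<open>The pattern of a bridge rule consists of distinct variables, so \<open>ts\<close> itself
  can be matched. Matching a smaller tuple, or evaluating the forwarded arguments to smaller terms,
  yields nothing new by \<open>mono\<close>; \<open>bot\<close> accounts for the \<open>CBot\<close>
  that \<open>T_op\<close> always adds.\<close>

lemma T_op_bridge:
  fixes B :: "('v, 'c, ('n, 'f) xsym) alg"
  assumes inf: "infinite (UNIV :: 'v set)" and f: "f \<in> X" and ts: "ts \<in> tuples sg f"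
    and bot: "CBot \<in> B (Lab E f) ts"
    and mono: "\<And>us. us \<in> tuples sg f \<Longrightarrow> list_all2 (\<sqsubseteq>) us ts \<Longrightarrow> B (Lab E f) us \<subseteq> B (Lab E f) ts"
  shows "T_op (ext_sig sg md) (bridge_rule sg E ` X) B (Vis f) ts = B (Lab E f) ts"
proof
  define n where "n = arF sg f"
  define xs :: "'v list" where "xs = map (fresh {}) [0..<n]"
  have rule: "bridge_rule sg E f = Rule (Vis f) (map CVar xs) (Fun (Lab E f) (map Var xs)) {}"
    by (simp add: bridge_rule_def xs_def n_def)
  have eval: "t \<in> eval B CVar (subst_trm \<theta> (Fun (Lab E f) (map Var xs))) \<longleftrightarrow>
    (\<exists>us. list_all2 (\<sqsubseteq>) us (map \<theta> xs) \<and> t \<in> B (Lab E f) us)" for \<theta> t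
    unfolding subst_trm.simps eval_Fun_iff by (simp add: list_all2_map2 eval_emb down_def)
  show "T_op (ext_sig sg md) (bridge_rule sg E ` X) B (Vis f) ts \<subseteq> B (Lab E f) ts"
  proof
    fix t assume "t \<in> T_op (ext_sig sg md) (bridge_rule sg E ` X) B (Vis f) ts"
    then consider "t = CBot"
      | ss r C where "Rule (Vis f) ss r C \<in> instances (ext_sig sg md) (bridge_rule sg E ` X)"
          "list_all2 (\<sqsubseteq>) ss ts" "t \<in> eval B CVar r"
      unfolding T_op_iff by blast
    then show "t \<in> B (Lab E f) ts"
    proof cases
      case 2
      obtain \<theta> ss' r' C' where "Rule (Vis f) ss' r' C' \<in> bridge_rule sg E ` X"
        and inst: "ss = map (subst_ct \<theta>) ss'" "r = subst_trm \<theta> r'"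
        using 2(1) by (rule instancesE)
      then have "Rule (Vis f) ss' r' C' = bridge_rule sg E f"
        by (auto simp: bridge_rule_def Let_def)
      then have eqs: "ss' = map CVar xs" "r' = Fun (Lab E f) (map Var xs)" by (simp_all add: rule)
      obtain us where us: "list_all2 (\<sqsubseteq>) us (map \<theta> xs)" "t \<in> B (Lab E f) us"
        using 2(3) unfolding inst eqs eval by blast
      have le: "list_all2 (\<sqsubseteq>) us ts"
        using approx_list_trans[OF us(1)] 2(2) unfolding inst eqs by (simp add: o_def)
      have "wf_ct sg u" if "u \<in> set us" for u
        using list_all2_set1[OF le that] ts wf_ct_approx by (auto simp: tuples_def CTerm_bot_def)
      then have "us \<in> tuples sg f"
        using list_all2_lengthD[OF le] ts by (auto simp: tuples_def CTerm_bot_def)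
      with mono le us(2) show ?thesis by blast
    qed (use bot in simp)
  qed
  show "B (Lab E f) ts \<subseteq> T_op (ext_sig sg md) (bridge_rule sg E ` X) B (Vis f) ts"
  proof
    fix t assume t: "t \<in> B (Lab E f) ts"
    have fresh: "inj (fresh {} :: nat \<Rightarrow> 'v)" using fresh_spec[OF inf finite.emptyI] by blast
    \<comment> \<open>The i-th pattern variable receives the i-th argument. The value elsewhere is
      irrelevant; \<open>CBot\<close> keeps the substitution well formed.\<close>
    define \<theta> where "\<theta> x = (if x \<in> fresh {} ` {..<n} then ts ! inv (fresh {}) x else CBot)"
      for x :: 'v
    have "\<theta> (fresh {} i) = ts ! i" if "i < n" for i
      using that fresh by (simp add: \<theta>_def)
    then have \<theta>xs: "map \<theta> xs = ts"
      using ts by (intro nth_equalityI) (simp_all add: xs_def tuples_def n_def)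
    have "ts ! i \<in> CTerm_bot sg" if "i < n" for i
      using ts that by (auto simp: tuples_def n_def)
    then have "\<theta> x \<in> CTerm_bot sg" for x
      using fresh by (auto simp: \<theta>_def CTerm_bot_def)
    then have \<theta>: "\<theta> \<in> CSubst_bot (ext_sig sg md)" by (simp add: CSubst_bot_def)
    have "Rule (Vis f) (map CVar xs) (Fun (Lab E f) (map Var xs)) {} \<in> bridge_rule sg E ` X"
      using f rule by (metis imageI)
    from instancesI[OF \<theta> this]
    have "Rule (Vis f) ts (subst_trm \<theta> (Fun (Lab E f) (map Var xs))) {} \<in>
      instances (ext_sig sg md) (bridge_rule sg E ` X)"
      by (simp add: o_def \<theta>xs del: subst_trm.simps)
    moreover have "t \<in> eval B CVar (subst_trm \<theta> (Fun (Lab E f) (map Var xs)))"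
      unfolding eval \<theta>xs using t approx_list_refl by blast
    moreover have "models_id (ext_sig sg md) B {}" by (simp add: models_id_def)
    ultimately show "t \<in> T_op (ext_sig sg md) (bridge_rule sg E ` X) B (Vis f) ts"
      unfolding T_op_iff using approx_list_refl by blast
  qed
qed

section \<open>Interpretation of the labeled symbols\<close>

text \<open>The value \<open>{CBot}\<close> at visible symbols is neutral in the join with
  \<open>ext_alg A\<close>, which in turn is neutral at labeled symbols; each half of the join
  decides its own symbols.\<close>

definition hidden_alg ::
    "('c, 'f) sig \<Rightarrow> ('n \<Rightarrow> ('v, 'c, 'f) rule set) \<Rightarrow> ('v, 'c, ('n, 'f) xsym) alg" where
  "hidden_alg sg md = (\<lambda>s ts. case s of Vis f \<Rightarrow> {CBot}
     | Lab P f \<Rightarrow> T_omega sg (denote sg md P) bot_alg f ts)"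

lemma hidden_alg_simps [simp]:
  "hidden_alg sg md (Vis f) ts = {CBot}"
  "hidden_alg sg md (Lab P f) ts = T_omega sg (denote sg md P) bot_alg f ts"
  by (simp_all add: hidden_alg_def)

lemma ext_alg_simps [simp]: "ext_alg A (Vis f) ts = A f ts" "ext_alg A (Lab E f) ts = {CBot}"
  by (simp_all add: ext_alg_def)

lemma typed_alg_hidden_alg:
  fixes md :: "'n \<Rightarrow> ('v, 'c, 'f) rule set"
  assumes "infinite (UNIV :: 'v set)"
  shows "typed_alg (ext_sig sg md) (hidden_alg sg md)"
  unfolding typed_alg_def
proof (intro ballI)
  fix s and ts :: "('v, 'c) ct list"
  assume s: "s \<in> FS (ext_sig sg md)" and ts: "ts \<in> tuples (ext_sig sg md) s"
  show "hidden_alg sg md s ts \<subseteq> CTerm_bot (ext_sig sg md)"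
  proof (cases s)
    case (Vis f)
    then show ?thesis by (simp add: CTerm_bot_def)
  next
    case (Lab P f)
    with s have "typed_alg sg (T_omega sg (denote sg md P) bot_alg)"
      by (intro term_alg_typed T_omega_term_alg admissible_denote[OF assms]) simp
    with s ts Lab show ?thesis by (simp add: typed_alg_def)
  qed
qed

lemma typed_alg_ext_alg:
  fixes A :: "('v, 'c, 'f) alg"
  shows "typed_alg sg A \<Longrightarrow> typed_alg (ext_sig sg md) (ext_alg A)"
  unfolding typed_alg_def
proof (intro ballI)
  fix s and ts :: "('v, 'c) ct list"
  assume "\<forall>f \<in> FS sg. \<forall>ts \<in> tuples sg f. A f ts \<subseteq> CTerm_bot sg"
    "s \<in> FS (ext_sig sg md)" "ts \<in> tuples (ext_sig sg md) s"
  then show "ext_alg A s ts \<subseteq> CTerm_bot (ext_sig sg md)"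
    by (cases s) (auto simp: CTerm_bot_def)
qed

lemma typed_alg_sup: "typed_alg sg A \<Longrightarrow> typed_alg sg B \<Longrightarrow> typed_alg sg (sup A B)"
  by (simp add: typed_alg_def)

text \<open>The interpretation of labels stays the same throughout the induction. \<open>A\<close>
  and \<open>f\<close> must vary, because a renaming passes to the algebra pulled back along it and
  to the symbols mapped to \<open>f\<close>.\<close>

lemma T_op_denote:
  fixes md :: "'n \<Rightarrow> ('v, 'c, 'f) rule set"
  assumes inf: "infinite (UNIV :: 'v set)" and "modular_expr sg md E" and "term_alg sg A"
    and "f \<in> FS sg" and "ts \<in> tuples sg f"
  shows "T_op sg (denote sg md E) A f ts =
    T_op (ext_sig sg md) (open_rules (iota sg md E)) (sup (hidden_alg sg md) (ext_alg A)) (Vis f) ts"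
  using assms(2-)
proof (induction E arbitrary: A f)
  case (Name n)
  have R: "admissible sg (md n)"
    using Name.prems by (simp add: plain_module_def admissible_program)
  have A: "CBot \<in> A g us" "A g us \<subseteq> CTerm_bot sg" if "g \<in> FS sg" "us \<in> tuples sg g" for g us
    using Name.prems(2) that approx_bot unfolding term_alg_def cone_def by blast+
  \<comment> \<open>The join adds \<open>CBot\<close> to the visible values. \<open>A\<close>
    already contains it at well-formed tuples, but perhaps not at others, so the two algebras are
    compared through \<open>T_op_mono_on\<close> and not identified.\<close>
  let ?B = "\<lambda>g. sup (hidden_alg sg md) (ext_alg A) (Vis g)"
  have B: "typed_alg sg ?B"
    using A by (auto simp: typed_alg_def CTerm_bot_def)
  have "T_op sg (md n) A f ts = T_op sg (md n) ?B f ts"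
  proof
    show "T_op sg (md n) A f ts \<subseteq> T_op sg (md n) ?B f ts"
      by (rule T_op_mono_on[OF term_alg_typed[OF Name.prems(2)] R, of UNIV]) auto
    show "T_op sg (md n) ?B f ts \<subseteq> T_op sg (md n) A f ts"
      by (rule T_op_mono_on[OF B R, of UNIV]) (auto simp: A)
  qed
  also have "\<dots> = T_op (ext_sig sg md) (map_rule_funs Vis ` md n)
      (sup (hidden_alg sg md) (ext_alg A)) (Vis f) ts"
    by (rule set_eqI) (auto simp: T_op_map[of "ext_sig sg md" sg])
  finally show ?case by (simp only: denote.simps iota.simps open_rules_simps)
next
  case (Union E F)
  then show ?case by (simp add: T_op_Un)
next
  case (Delete E \<sigma>)
  then show ?case by (auto simp: T_op_delete)
next
  case (Rename \<rho> E)
  let ?A = "\<lambda>f. A (\<rho> f)"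
  have \<rho>: "\<rho> g \<in> FS sg" "tuples sg (\<rho> g) = (tuples sg g :: ('v, 'c) ct list set)"
    if "g \<in> FS sg" for g
    using Rename.prems(1) that by (auto simp: tuples_def)
  have A: "term_alg sg ?A"
    using Rename.prems(2) \<rho> unfolding term_alg_def by simp
  have alg: "(\<lambda>x. sup (hidden_alg sg md) (ext_alg A) (rename_vis \<rho> x)) =
      sup (hidden_alg sg md) (ext_alg ?A)"
  proof (intro ext)
    fix x us
    show "sup (hidden_alg sg md) (ext_alg A) (rename_vis \<rho> x) us =
        sup (hidden_alg sg md) (ext_alg ?A) x us"
      by (cases x) simp_all
  qed
  have E: "modular_expr sg md E" using Rename.prems(1) by simp
  have IH: "T_op sg (denote sg md E) ?A g ts =
      T_op (ext_sig sg md) (open_rules (iota sg md E)) (sup (hidden_alg sg md) (ext_alg ?A)) (Vis g) ts"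
    if g: "\<rho> g = f" for g
  proof (cases "g \<in> FS sg")
    case True
    with Rename.IH[OF E A] Rename.prems(4) \<rho>(2) g show ?thesis by blast
  next
    \<comment> \<open>A renaming is unconstrained outside the signature and may send a foreign
      \<open>g\<close> to \<open>f\<close>. Such a \<open>g\<close> heads no rule on either
      side.\<close>
    case False
    then have "g \<notin> exports (denote sg md E)" "Vis g \<notin> exports (open_rules (iota sg md E))"
      using admissible_exports[OF admissible_denote[OF inf E]]
        admissible_exports[OF admissible_open_rules[OF E]] by auto
    then show ?thesis by (simp add: T_op_not_head)
  qed
  have vis: "rename_vis \<rho> x = Vis f \<longleftrightarrow> (\<exists>g. x = Vis g \<and> \<rho> g = f)" for x
    by (cases x) auto
  show ?case
  proof (rule set_eqI)
    fix t
    have "t \<in> T_op sg (denote sg md (Rename \<rho> E)) A f ts \<longleftrightarrow>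
        t = CBot \<or> (\<exists>g. \<rho> g = f \<and> t \<in> T_op sg (denote sg md E) ?A g ts)"
      by (simp only: denote.simps T_op_map[of sg sg, OF refl refl])
    also have "\<dots> \<longleftrightarrow> t = CBot \<or> (\<exists>x. rename_vis \<rho> x = Vis f \<and>
        t \<in> T_op (ext_sig sg md) (open_rules (iota sg md E))
          (\<lambda>x. sup (hidden_alg sg md) (ext_alg A) (rename_vis \<rho> x)) x ts)"
      unfolding alg vis using IH by blast
    also have "\<dots> \<longleftrightarrow> t \<in> T_op (ext_sig sg md) (open_rules (iota sg md (Rename \<rho> E)))
        (sup (hidden_alg sg md) (ext_alg A)) (Vis f) ts"
      by (simp only: iota.simps open_rules_simps
          T_op_map[of "ext_sig sg md" "ext_sig sg md", OF refl refl])
    finally show "t \<in> T_op sg (denote sg md (Rename \<rho> E)) A f ts \<longleftrightarrow>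
        t \<in> T_op (ext_sig sg md) (open_rules (iota sg md (Rename \<rho> E)))
          (sup (hidden_alg sg md) (ext_alg A)) (Vis f) ts" .
  qed
next
  case (Closure E)
  let ?W = "T_omega sg (denote sg md E) bot_alg"
  have E: "modular_expr sg md E" using Closure.prems(1) by simp
  have R: "admissible sg (denote sg md E)" by (rule admissible_denote[OF inf E])
  have "T_op sg (denote sg md (Closure E)) A f ts = ?W f ts"
    using T_op_closure[OF inf R] Closure.prems by simp
  also have "\<dots> = T_op (ext_sig sg md) (open_rules (iota sg md (Closure E)))
      (sup (hidden_alg sg md) (ext_alg A)) (Vis f) ts"
  \<comment> \<open>A bridge exists exactly for the symbols exported by the representation of
    \<open>E\<close>; without one, both sides are \<open>{CBot}\<close>.\<close>
  proof (cases "Vis f \<in> exports (open_rules (iota sg md E))")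
    case True
    have eq: "sup (hidden_alg sg md) (ext_alg A) (Lab E f) us = ?W f us" for us
      by (simp add: insert_absorb)
    have "?W f us \<subseteq> ?W f ts" if "us \<in> tuples sg f" "list_all2 (\<sqsubseteq>) us ts" for us
      using T_omega_term_alg[OF R] Closure.prems that unfolding term_alg_def by blast
    then show ?thesis
      using T_op_bridge[OF inf, of f "{f. Vis f \<in> exports (open_rules (iota sg md E))}" ts sg
          "sup (hidden_alg sg md) (ext_alg A)" E md] True Closure.prems(4)
      unfolding eq by simp
  next
    case False
    then have "f \<notin> exports (denote sg md E)" using exports_denote[of f sg md E] by blast
    moreover have "Vis f \<notin> exports (open_rules (iota sg md (Closure E)))"
      using False by (auto simp: exports_bridge)
    ultimately show ?thesis by (simp add: T_omega_not_head T_op_not_head)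
  qed
  finally show ?case .
qed

section \<open>The interpretation of labels against the least fixpoint of the hidden rules\<close>

lemma exports_hidden: "x \<in> exports (hidden (iota sg md E)) \<Longrightarrow> \<exists>P \<in> closed_subs E. \<exists>f. x = Lab P f"
  unfolding hidden_iota exports_def using open_rules_funs by fastforce

text \<open>Rules headed by a symbol with label \<open>P\<close> come from the block of
  \<open>P\<close> alone, because open rules have visible heads and \<open>tau\<close> puts the
  label of its block on them. Undoing \<open>tau P\<close> leaves the two preimages
  \<open>Vis f\<close> and \<open>Lab P f\<close>, and the second heads no open rule.\<close>

lemma T_op_hidden:
  fixes md :: "'n \<Rightarrow> ('v, 'c, 'f) rule set"
  assumes "P \<in> closed_subs E"
  shows "T_op (ext_sig sg md) (hidden (iota sg md E)) B (Lab P f) ts =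
    T_op (ext_sig sg md) (open_rules (iota sg md P)) (\<lambda>x. B (tau P x)) (Vis f) ts"
proof -
  have "T_op (ext_sig sg md) (hidden (iota sg md E)) B (Lab P f) ts =
      T_op (ext_sig sg md) (map_rule_funs (tau P) ` open_rules (iota sg md P)) B (Lab P f) ts"
  proof (rule T_op_cong_heads)
    fix \<rho> :: "('v, 'c, ('n, 'f) xsym) rule"
    assume head: "head \<rho> = Lab P f"
    show "\<rho> \<in> hidden (iota sg md E) \<longleftrightarrow> \<rho> \<in> map_rule_funs (tau P) ` open_rules (iota sg md P)"
    proof
      assume "\<rho> \<in> hidden (iota sg md E)"
      then obtain Q \<rho>' where Q: "\<rho>' \<in> open_rules (iota sg md Q)" "\<rho> = map_rule_funs (tau Q) \<rho>'"
        unfolding hidden_iota by blast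
      then have "Q = P" using head open_rules_funs[OF Q(1)] by auto
      with Q show "\<rho> \<in> map_rule_funs (tau P) ` open_rules (iota sg md P)" by blast
    qed (use assms hidden_iota in blast)
  qed
  moreover have "Lab P f \<notin> exports (open_rules (iota sg md P))"
    using open_rules_funs by (fastforce simp: exports_def)
  then have "T_op (ext_sig sg md) (open_rules (iota sg md P)) B' (Lab P f) ts = {CBot}" for B'
    by (rule T_op_not_head)
  moreover have "tau P x = Lab P f \<longleftrightarrow> x = Vis f \<or> x = Lab P f" for x
    by (cases x) auto
  ultimately show ?thesis
    by (auto simp: T_op_map[of "ext_sig sg md" "ext_sig sg md"])
qed

lemma admissible_hidden:
  assumes "modular_expr sg md E"
  shows "admissible (ext_sig sg md) (hidden (iota sg md E))"
proof -
  have "admissible (ext_sig sg md) (map_rule_funs (tau P) ` open_rules (iota sg md P))"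
    if "P \<in> closed_subs E" for P
  proof (rule admissible_map)
    have P: "modular_expr sg md P" using closed_subs_modular that assms by blast
    have "tau P x \<in> FS (ext_sig sg md) \<and> arF (ext_sig sg md) (tau P x) = arF (ext_sig sg md) x"
      if "x \<in> FS (ext_sig sg md)" for x
      using that P by (cases x) auto
    then show "sig_map (ext_sig sg md) (ext_sig sg md) (tau P)" by (simp add: sig_map_def)
    show "admissible (ext_sig sg md) (open_rules (iota sg md P))" by (rule admissible_open_rules[OF P])
  qed
  then show ?thesis unfolding hidden_iota admissible_def by blast
qed

text \<open>Fixpoint induction: \<open>hidden_alg\<close> absorbs one application of the hidden
  rules. At a symbol labeled \<open>P\<close> this reduces, by \<open>T_op_hidden\<close> and by
  \<open>T_op_denote\<close> read from right to left, to the prefixpoint property of the least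
  fixpoint for \<open>P\<close>.\<close>

lemma T_omega_hidden_le:
  fixes md :: "'n \<Rightarrow> ('v, 'c, 'f) rule set"
  assumes inf: "infinite (UNIV :: 'v set)" and E: "modular_expr sg md E"
    and "x \<in> FS (ext_sig sg md)" and "ts \<in> tuples (ext_sig sg md) x"
  shows "T_omega (ext_sig sg md) (hidden (iota sg md E)) bot_alg x ts \<subseteq> hidden_alg sg md x ts"
proof -
  let ?H = "hidden (iota sg md E)" and ?xs = "ext_sig sg md"
  have bot: "CBot \<in> hidden_alg sg md x ts" for x ts by (cases x) simp_all
  have "approximant ?xs ?H n x ts \<subseteq> hidden_alg sg md x ts"
    if "x \<in> FS ?xs" "ts \<in> tuples ?xs x" for n x ts
    using that
  proof (induction n arbitrary: x ts)
    case 0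
    have "approximant ?xs ?H 0 x ts = {CBot}" by (simp add: bot_alg_def)
    with bot show ?case by (simp only: insert_subset empty_subsetI simp_thms)
  next
    case (Suc n)
    show ?case
    proof (cases "x \<in> exports ?H")
      case False
      then have "approximant ?xs ?H (Suc n) x ts = {CBot}" by (simp add: T_op_not_head)
      with bot show ?thesis by (simp only: insert_subset empty_subsetI simp_thms)
    next
      case True
      from exports_hidden[OF this] obtain P f where P: "P \<in> closed_subs E" and x: "x = Lab P f"
        by blast
      let ?W = "T_omega sg (denote sg md P) bot_alg"
      have mod: "modular_expr sg md P" using closed_subs_modular[OF P E] .
      have R: "admissible sg (denote sg md P)" by (rule admissible_denote[OF inf mod])
      \<comment> \<open>Seen through \<open>tau P\<close>, visible symbols are interpreted in the
        least fixpoint for \<open>P\<close> and labeled ones as before. This is exactly the algebra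
        that \<open>T_op_denote\<close> produces from \<open>?W\<close>.\<close>
      have alg: "(\<lambda>x. hidden_alg sg md (tau P x)) = sup (hidden_alg sg md) (ext_alg ?W)"
      proof (intro ext)
        fix y us
        show "hidden_alg sg md (tau P y) us = sup (hidden_alg sg md) (ext_alg ?W) y us"
          by (cases y) (simp_all add: insert_absorb)
      qed
      have "approximant ?xs ?H (Suc n) x ts \<subseteq> T_op ?xs ?H (hidden_alg sg md) x ts"
        unfolding funpow.simps o_apply
      proof (rule T_op_mono_on[OF _ admissible_hidden[OF E], where F = UNIV])
        show "typed_alg ?xs (approximant ?xs ?H n)"
          using approximant_CTAlg[OF admissible_hidden[OF E]] term_alg_typed by blast
        show "approximant ?xs ?H n y us \<subseteq> hidden_alg sg md y us"
          if "y \<in> FS ?xs" "us \<in> tuples ?xs y" for y us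
          using that by (rule Suc.IH)
      qed simp
      also have "\<dots> = T_op ?xs (open_rules (iota sg md P)) (sup (hidden_alg sg md) (ext_alg ?W)) (Vis f) ts"
        unfolding x T_op_hidden[OF P] alg by (rule refl)
      also have "\<dots> = T_op sg (denote sg md P) ?W f ts"
        using Suc.prems by (intro T_op_denote[OF inf mod T_omega_term_alg[OF R], symmetric])
          (simp_all add: x)
      also have "\<dots> \<subseteq> hidden_alg sg md x ts"
        unfolding x hidden_alg_simps by (rule T_omega_prefixpoint[OF R])
      finally show ?thesis .
    qed
  qed
  then show ?thesis
    unfolding T_omega_apply[of ?xs ?H bot_alg x ts] using assms(3,4) by (intro UN_least)
qed

text \<open>A double induction: outside on the size of the label \<open>P\<close>, inside on the
  stage of the iteration for \<open>P\<close>, while the right-hand side remains the fixpoint for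
  all of \<open>E\<close>.\<close>

lemma T_omega_denote_le:
  fixes md :: "'n \<Rightarrow> ('v, 'c, 'f) rule set"
  assumes inf: "infinite (UNIV :: 'v set)" and E: "modular_expr sg md E"
    and "P \<in> closed_subs E" and "f \<in> FS sg" and "ts \<in> tuples sg f"
  shows "T_omega sg (denote sg md P) bot_alg f ts \<subseteq>
    T_omega (ext_sig sg md) (hidden (iota sg md E)) bot_alg (Lab P f) ts"
  using assms(3-)
proof (induction P arbitrary: f ts rule: measure_induct_rule[of size])
  case (less P)
  let ?H = "hidden (iota sg md E)" and ?xs = "ext_sig sg md" and ?R = "denote sg md P"
  let ?L = "T_omega ?xs ?H bot_alg"
  have mod: "modular_expr sg md P" using closed_subs_modular[OF less.prems(1) E] .
  have R: "admissible sg ?R" by (rule admissible_denote[OF inf mod])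
  have "approximant sg ?R n f ts \<subseteq> ?L (Lab P f) ts" if "f \<in> FS sg" "ts \<in> tuples sg f" for n f ts
    using that
  proof (induction n arbitrary: f ts)
    case 0
    have "approximant sg ?R 0 f ts = {CBot}" by (simp add: bot_alg_def)
    then show ?case by simp
  next
    case (Suc n)
    let ?A = "approximant sg ?R n"
    have A: "term_alg sg ?A" using approximant_CTAlg[OF R] by blast
    have "approximant sg ?R (Suc n) f ts =
        T_op ?xs (open_rules (iota sg md P)) (sup (hidden_alg sg md) (ext_alg ?A)) (Vis f) ts"
      using T_op_denote[OF inf mod A] Suc.prems by simp
    \<comment> \<open>Visible symbols become symbols labeled \<open>P\<close> and fall under the
      inner hypothesis at stage \<open>n\<close>. Labels \<open>Q\<close> occurring in the rules are
      closed inside \<open>P\<close>, hence smaller, and fall under the outer one.\<close>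
    also have "\<dots> \<subseteq> T_op ?xs (open_rules (iota sg md P)) (\<lambda>x. ?L (tau P x)) (Vis f) ts"
    proof (rule T_op_mono_on[OF _ admissible_open_rules[OF mod],
          where F = "range Vis \<union> {Lab Q g | Q g. Q \<in> closed_subs P}"])
      show "typed_alg ?xs (sup (hidden_alg sg md) (ext_alg ?A))"
        by (intro typed_alg_sup typed_alg_hidden_alg[OF inf] typed_alg_ext_alg term_alg_typed A)
      fix x and us :: "('v, 'c) ct list"
      assume x: "x \<in> range Vis \<union> {Lab Q g | Q g. Q \<in> closed_subs P}" "x \<in> FS ?xs" "us \<in> tuples ?xs x"
      show "sup (hidden_alg sg md) (ext_alg ?A) x us \<subseteq> ?L (tau P x) us"
      proof (cases x)
        case (Vis g)
        then show ?thesis using Suc.IH x by simp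
      next
        case (Lab Q g)
        then have "Q \<in> closed_subs P" using x by auto
        then show ?thesis
          using less.IH[OF closed_subs_size] closed_subs_trans[OF less.prems(1)] Lab x by auto
      qed
    qed (use open_rules_funs in blast)
    also have "\<dots> = T_op ?xs ?H ?L (Lab P f) ts"
      by (rule T_op_hidden[OF less.prems(1), symmetric])
    also have "\<dots> \<subseteq> ?L (Lab P f) ts"
      by (rule T_omega_prefixpoint[OF admissible_hidden[OF E]])
    finally show ?case .
  qed
  from UN_least[OF this[OF less.prems(2,3)]] show ?case
    unfolding T_omega_apply[of sg ?R] .
qed

theorem theorem8p2:
  fixes sg :: "('c, 'f) sig"
    and md :: "'n \<Rightarrow> ('v, 'c, 'f) rule set"
    and E :: "('n, 'f) mexp"
  assumes "signature sg"
    and "countable (UNIV :: 'v set)" and "infinite (UNIV :: 'v set)"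
    and "modular_expr sg md E"
  shows "\<forall>A \<in> CTAlg sg.
    alg_eq sg (T_op sg (denote sg md E) A) (U_op sg md (iota sg md E) A)"
  unfolding alg_eq_def
proof (intro ballI)
  note inf = assms(3) and E = assms(4)
  fix A :: "('v, 'c, 'f) alg" and f and ts :: "('v, 'c) ct list"
  assume "A \<in> CTAlg sg" and f: "f \<in> FS sg" and ts: "ts \<in> tuples sg f"
  then have A: "term_alg sg A" by (simp add: CTAlg_def)
  let ?xs = "ext_sig sg md" and ?R = "open_rules (iota sg md E)"
  let ?L = "T_omega ?xs (hidden (iota sg md E)) bot_alg"
  let ?F = "range Vis \<union> {Lab P g | P g. P \<in> closed_subs E}"
  have R: "admissible ?xs ?R" by (rule admissible_open_rules[OF E])
  have L: "typed_alg ?xs ?L" by (rule term_alg_typed[OF T_omega_term_alg[OF admissible_hidden[OF E]]])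
  note typed = typed_alg_ext_alg[OF term_alg_typed[OF A], of md]
  have funs: "rule_funs \<rho> \<subseteq> ?F" if "\<rho> \<in> ?R" for \<rho> using open_rules_funs that by blast
  have "T_op sg (denote sg md E) A f ts = T_op ?xs ?R (sup (hidden_alg sg md) (ext_alg A)) (Vis f) ts"
    by (rule T_op_denote[OF inf E A f ts])
  also have "\<dots> = T_op ?xs ?R (sup ?L (ext_alg A)) (Vis f) ts"
  proof
    show "T_op ?xs ?R (sup ?L (ext_alg A)) (Vis f) ts \<subseteq>
        T_op ?xs ?R (sup (hidden_alg sg md) (ext_alg A)) (Vis f) ts"
      by (rule T_op_mono_on[OF typed_alg_sup[OF L typed] R _ funs])
        (use T_omega_hidden_le[OF inf E] in auto)
    \<comment> \<open>Here the restriction to \<open>?F\<close> matters: at labels that are not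
      closed inside \<open>E\<close> the fixpoint \<open>?L\<close> is \<open>{CBot}\<close>, while
      \<open>hidden_alg\<close> may be larger. No such label occurs in \<open>?R\<close>.\<close>
    show "T_op ?xs ?R (sup (hidden_alg sg md) (ext_alg A)) (Vis f) ts \<subseteq>
        T_op ?xs ?R (sup ?L (ext_alg A)) (Vis f) ts"
    proof (rule T_op_mono_on[OF typed_alg_sup[OF typed_alg_hidden_alg[OF inf] typed] R _ funs])
      fix x and us :: "('v, 'c) ct list"
      assume x: "x \<in> ?F" "x \<in> FS ?xs" "us \<in> tuples ?xs x"
      have "hidden_alg sg md x us \<subseteq> ?L x us"
        using T_omega_denote_le[OF inf E] x by (cases x) auto
      then show "sup (hidden_alg sg md) (ext_alg A) x us \<subseteq> sup ?L (ext_alg A) x us" by auto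
    qed
  qed
  also have "\<dots> = U_op sg md (iota sg md E) A f ts"
    by (simp add: U_op_def restrict_alg_def open_rules_def)
  finally show "T_op sg (denote sg md E) A f ts = U_op sg md (iota sg md E) A f ts" .
qed

end
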